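(* Let $T:\mathbf{M}_2(\mathbb{C})\to\mathbf{M}_2(\mathbb{C})$ be a complex linear map. (a) $T$ preserves TEA pairs if and only if there are $\gamma\ge 0$ and $U,V\in\mathbf{U}_2(\mathbb{C})$ such that $T$ has the form $A\mapsto \gamma UAV$ or the form $A\mapsto\gamma UA^{\mathrm{t}}V$. (b) $T$ preserves parallel pairs if and only if one of the following holds. (b.1) $T$ has the form $A\mapsto \operatorname{trace}(FA)Z$ for some $F,Z\in\mathbf{M}_2(\mathbb{C})$. (b.2) There are $U_1,U_2,V_1,V_2\in\mathbf{U}_2(\mathbb{C})$ such that the matrix representation, with respect to the basis $\mathbf{C}$, of the linear transformation $\tilde T$ defined by $A\mapsto U_1T(U_2AV_2)V_1$ has the form $$[\tilde T]_{\mathbf{C}}=\begin{pmatrix} d_0&\gamma_1 i&\gamma_2 i&\gamma_3 i\\ 0&d_1&0&0\\ 0&0&d_2&0\\ 0&0&0&d_3\end{pmatrix}$$ for real scalars $d_0,d_1,d_2,d_3,\gamma_1,\gamma_2,\gamma_3$.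
   Context: $\mathbf{M}_2(\mathbb{C})$ is the space of $2\times 2$ complex matrices with the spectral (operator) norm $\|A\|=\max\{\|Ax\|: x\in\mathbb{C}^2,\|x\|=1\}$ (Euclidean norms on $\mathbb{C}^2$). $\mathbf{U}_2(\mathbb{C})$ is the group of $2\times2$ complex unitary matrices. $A^{\mathrm{t}}$ is the transpose of $A$. Matrices $A,B$ are parallel (form a parallel pair) if $\|A+\mu B\|=\|A\|+\|B\|$ for some $\mu\in\mathbb{C}$ with $|\mu|=1$; they form a triangle equality attaining (TEA) pair if $\|A+B\|=\|A\|+\|B\|$. A linear map $T$ preserves parallel pairs (resp. TEA pairs) if $T(A),T(B)$ are parallel (resp. form a TEA pair) whenever $A,B$ are parallel (resp. form a TEA pair). Let $I_2=\begin{pmatrix}1&0\\0&1\end{pmatrix}$, $\mathcal{C}_1=\begin{pmatrix}1&0\\0&-1\end{pmatrix}$, $\mathcal{C}_2=\begin{pmatrix}0&1\\1&0\end{pmatrix}$, $\mathcal{C}_3=\begin{pmatrix}0&-i\\ i&0\end{pmatrix}$. Then $\mathbf{C}=\{I_2/\sqrt2,\mathcal{C}_1/\sqrt2,\mathcal{C}_2/\sqrt2,\mathcal{C}_3/\sqrt2\}$ (in this order) is an orthonormal basis of $\mathbf{M}_2(\mathbb{C})$ with respect to $\langle A,B\rangle=\operatorname{trace}(B^*A)$. In a matrix representation, the columns are the coordinate vectors of the images of the basis elements. *)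

theory Defs
  imports "HOL-Analysis.Analysis"
begin

text \<open>The norm of \<^typ>\<open>complex^'n^'m\<close> as an iterated Cartesian product is the Frobenius norm,
  so the operator norm has to be introduced separately; \<^typ>\<open>complex^'n\<close> itself carries the
  Euclidean norm.\<close>

definition spectral_norm :: "complex^'n^'m \<Rightarrow> real"
  where "spectral_norm A = onorm ((*v) A)"

definition cscale :: "complex \<Rightarrow> complex^'n^'m \<Rightarrow> complex^'n^'m"  (infixr \<open>*\<^sub>M\<close> 75)
  where "c *\<^sub>M A = (\<chi> i j. c * A $ i $ j)"

definition adjoint_matrix :: "complex^'n^'m \<Rightarrow> complex^'m^'n"
  where "adjoint_matrix A = (\<chi> i j. cnj (A $ j $ i))"

definition unitary_matrix :: "complex^'n^'n \<Rightarrow> bool"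
  where "unitary_matrix U \<longleftrightarrow>
    adjoint_matrix U ** U = mat 1 \<and> U ** adjoint_matrix U = mat 1"

definition parallel :: "complex^'n^'m \<Rightarrow> complex^'n^'m \<Rightarrow> bool"
  where "parallel A B \<longleftrightarrow>
    (\<exists>\<mu>. cmod \<mu> = 1 \<and> spectral_norm (A + \<mu> *\<^sub>M B) = spectral_norm A + spectral_norm B)"

definition TEA :: "complex^'n^'m \<Rightarrow> complex^'n^'m \<Rightarrow> bool"
  where "TEA A B \<longleftrightarrow> spectral_norm (A + B) = spectral_norm A + spectral_norm B"

definition preserves_parallel :: "(complex^'n^'m \<Rightarrow> complex^'n^'m) \<Rightarrow> bool"
  where "preserves_parallel T \<longleftrightarrow> (\<forall>A B. parallel A B \<longrightarrow> parallel (T A) (T B))"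

definition preserves_TEA :: "(complex^'n^'m \<Rightarrow> complex^'n^'m) \<Rightarrow> bool"
  where "preserves_TEA T \<longleftrightarrow> (\<forall>A B. TEA A B \<longrightarrow> TEA (T A) (T B))"

definition pauli1 :: "complex^2^2"
  where "pauli1 = vector [vector [1, 0], vector [0, -1]]"

definition pauli2 :: "complex^2^2"
  where "pauli2 = vector [vector [0, 1], vector [1, 0]]"

definition pauli3 :: "complex^2^2"
  where "pauli3 = vector [vector [0, -\<i>], vector [\<i>, 0]]"

text \<open>The ordered basis; the entries are indexed by 1, 2, 3, 4 (and \<^term>\<open>4 = (0::4)\<close>).\<close>

definition pauli_basis :: "(complex^2^2)^4"
  where "pauli_basis = vector
    [complex_of_real (1 / sqrt 2) *\<^sub>M mat 1,
     complex_of_real (1 / sqrt 2) *\<^sub>M pauli1,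
     complex_of_real (1 / sqrt 2) *\<^sub>M pauli2,
     complex_of_real (1 / sqrt 2) *\<^sub>M pauli3]"

interpretation cmat: vector_space "cscale :: complex \<Rightarrow> complex^'n^'m \<Rightarrow> complex^'n^'m"
  by unfold_locales (simp_all add: cscale_def vec_eq_iff algebra_simps)

text \<open>Column \<open>j\<close> consists of the coordinates of the image of the \<open>j\<close>-th basis element.\<close>

definition pauli_matrix_of :: "(complex^2^2 \<Rightarrow> complex^2^2) \<Rightarrow> complex^4^4"
  where "pauli_matrix_of T =
    (\<chi> i j. cmat.representation (range (($) pauli_basis)) (T (pauli_basis $ j)) (pauli_basis $ i))"


text \<open>Consistency with the description of the norm as a maximum over the unit sphere, and with
  the description of \<^const>\<open>pauli_basis\<close> as an orthonormal basis.\<close>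

lemma bounded_linear_cmatrix_vector_mult: "bounded_linear ((*v) (A :: complex^'n^'m))"
proof (rule linear_conv_bounded_linear[THEN iffD1], rule linearI)
  show "A *v (r *\<^sub>R x) = r *\<^sub>R (A *v x)" for r x
    by (simp add: matrix_vector_mult_def vec_eq_iff scaleR_sum_right)
qed (simp add: matrix_vector_right_distrib)

lemma spectral_norm_max:
  fixes A :: "complex^'n^'m"
  shows "\<exists>x. norm x = 1 \<and> norm (A *v x) = spectral_norm A"
    and "norm x = 1 \<Longrightarrow> norm (A *v x) \<le> spectral_norm A"
proof -
  note bl = bounded_linear_cmatrix_vector_mult[of A]
  interpret bounded_linear "(*v) A" by (fact bl)
  show le: "norm (A *v x) \<le> spectral_norm A" if "norm x = 1" for x
    using onorm[OF bl, of x] that by (simp add: spectral_norm_def)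
  have "norm (axis undefined 1 :: complex^'n) = 1" by (simp add: norm_axis_1)
  then have "sphere 0 1 \<noteq> ({} :: (complex^'n) set)" by (metis empty_iff mem_sphere_0)
  moreover have "continuous_on (sphere 0 1) (\<lambda>x. norm (A *v x))"
    by (intro continuous_on_norm continuous_on continuous_on_id)
  ultimately obtain x where x: "norm x = 1" "\<And>y. norm y = 1 \<Longrightarrow> norm (A *v y) \<le> norm (A *v x)"
    using continuous_attains_sup[OF compact_sphere] by (metis mem_sphere_0)
  have "norm (A *v y) \<le> norm (A *v x) * norm y" for y
  proof (cases "y = 0")
    case False
    then have "norm (A *v (inverse (norm y) *\<^sub>R y)) \<le> norm (A *v x)" by (intro x(2)) simp
    then show ?thesis using False by (simp add: scaleR field_simps)
  qed (simp add: zero)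
  then have "spectral_norm A \<le> norm (A *v x)"
    unfolding spectral_norm_def by (intro onorm_bound) auto
  with le[OF x(1)] x(1) show "\<exists>x. norm x = 1 \<and> norm (A *v x) = spectral_norm A" by force
qed

lemma pauli_basis_nth:
  "pauli_basis $ 1 = complex_of_real (1 / sqrt 2) *\<^sub>M mat 1"
  "pauli_basis $ 2 = complex_of_real (1 / sqrt 2) *\<^sub>M pauli1"
  "pauli_basis $ 3 = complex_of_real (1 / sqrt 2) *\<^sub>M pauli2"
  "pauli_basis $ 4 = complex_of_real (1 / sqrt 2) *\<^sub>M pauli3"
  by (simp_all add: pauli_basis_def vector_def)

lemma pauli_basis_orthonormal:
  "trace (adjoint_matrix (pauli_basis $ i) ** pauli_basis $ j) = (if i = j then 1 else 0)"
proof -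
  have [simp]: "complex_of_real (sqrt 2) * complex_of_real (sqrt 2) = 2"
    by (simp flip: of_real_mult)
  show ?thesis
    using exhaust_4[of i] exhaust_4[of j]
    by (auto simp: pauli_basis_nth trace_def matrix_matrix_mult_def adjoint_matrix_def cscale_def
        mat_def pauli1_def pauli2_def pauli3_def sum_2)
qed

lemma pauli_basis_inj: "inj (($) pauli_basis)"
  by (rule injI) (metis pauli_basis_orthonormal zero_neq_one)

lemma pauli_basis_independent: "cmat.independent (range (($) pauli_basis))"
proof -
  have "f j = 0" if z: "(\<Sum>i\<in>UNIV. f i *\<^sub>M pauli_basis $ i) = 0" for f :: "4 \<Rightarrow> complex" and j
  proof -
    let ?t = "\<lambda>A. trace (adjoint_matrix (pauli_basis $ j) ** A)"
    have add: "?t (A + B) = ?t A + ?t B" for A B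
      by (simp add: trace_def matrix_matrix_mult_def sum.distrib algebra_simps)
    have scl: "?t (c *\<^sub>M A) = c * ?t A" for c A
      by (simp add: trace_def matrix_matrix_mult_def cscale_def sum_distrib_left algebra_simps)
    have t0: "?t 0 = 0" by (simp add: trace_def zero_vec_def matrix_matrix_mult_def)
    have "?t (\<Sum>i\<in>S. f i *\<^sub>M pauli_basis $ i) = (\<Sum>i\<in>S. f i * ?t (pauli_basis $ i))"
      if "finite S" for S
      using that by induction (simp_all add: t0[simplified] add scl)
    from this[of UNIV] show ?thesis
      by (simp add: z t0[simplified] pauli_basis_orthonormal if_distrib cong: if_cong)
  qed
  note indep = this
  show ?thesis
  proof (rule cmat.independent_if_scalars_zero)
    fix g x assume g: "(\<Sum>x\<in>range (($) pauli_basis). g x *\<^sub>M x) = 0"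
      and "x \<in> range (($) pauli_basis)"
    then obtain j where j: "x = pauli_basis $ j" by auto
    have "(\<Sum>i\<in>UNIV. g (pauli_basis $ i) *\<^sub>M pauli_basis $ i) = 0"
      using g by (simp add: sum.reindex[OF pauli_basis_inj])
    from indep[OF this] show "g x = 0" by (simp add: j)
  qed simp
qed

lemma pauli_basis_span: "cmat.span (range (($) pauli_basis)) = UNIV"
proof -
  have "A \<in> cmat.span (range (($) pauli_basis))" for A :: "complex^2^2"
  proof -
    have [simp]: "complex_of_real (sqrt 2) * complex_of_real (sqrt 2) = 2"
      by (simp flip: of_real_mult)
    have [simp]: "complex_of_real (sqrt 2) * (complex_of_real (sqrt 2) * z) = 2 * z" for z
      by (simp flip: mult.assoc)
    let ?s = "complex_of_real (sqrt 2) / 2"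
    have "A = (?s * (A$1$1 + A$2$2)) *\<^sub>M pauli_basis $ 1 + (?s * (A$1$1 - A$2$2)) *\<^sub>M pauli_basis $ 2
       + (?s * (A$1$2 + A$2$1)) *\<^sub>M pauli_basis $ 3 + (?s * \<i> * (A$1$2 - A$2$1)) *\<^sub>M pauli_basis $ 4"
      by (simp add: vec_eq_iff forall_2 pauli_basis_nth cscale_def mat_def pauli1_def pauli2_def
          pauli3_def field_simps)
    also have "\<dots> \<in> cmat.span (range (($) pauli_basis))"
      by (intro cmat.span_add cmat.span_scale cmat.span_base rangeI)
    finally show ?thesis .
  qed
  then show ?thesis by blast
qed

end

theory Submission
  imports Defs
begin

text \<open>The quaternions sit in the complex \<open>2 \<times> 2\<close> matrices as the real four-dimensional space
  of all \<open>quat p q\<close>, with the unit quaternions being \<open>SU(2)\<close>, and every matrix is \<open>X + \<i> Y\<close>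
  with quaternions \<open>X\<close> and \<open>Y\<close>. Up to factors \<open>\<i>\<close> and \<open>\<surd>2\<close> the Pauli basis is the standard
  quaternion basis, so part (b.2) says that, up to unitary factors, the map is the complexification of a
  real linear map of the quaternions. The theorem is about this real structure.

  Two matrices are parallel exactly when some \<open>U\<close>, \<open>V\<close> in \<open>SU(2)\<close> turn both into diagonal
  matrices whose first entry is the dominant one, and they attain the triangle equality exactly when
  these dominant entries can moreover be made nonnegative (\<open>TEA_diagonalize\<close>,
  \<open>parallel_diagonalize\<close>, \<open>TEA_diagI\<close>, \<open>parallel_diagI1\<close>). The real points of the space of diagonal
  matrices form a plane of quaternions, and the first entry of \<open>p P + q Q\<close> dominates or not
  according to the orientation, the sign of \<open>Im (p cnj q)\<close>. So parallel means: lying in the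
  complexification of one real plane and not having opposite orientations there. A complexified real map
  carries planes to planes and keeps equal orientations equal, hence it preserves parallelism
  (\<open>pencil_parallel\<close>, \<open>quaternionic_preserves_parallel\<close>).

  Conversely let \<open>T\<close> preserve parallelism. Any two quaternions are parallel. If a quaternion were
  sent to a matrix that is not a complex multiple of a quaternion, that matrix would have two distinct
  singular values and hence determine its plane, so that the image of \<open>T\<close> would lie in the
  space of diagonal matrices, and comparing dominance for a suitable matrix and its quaternion parts leaves only
  rank one (\<open>rank_one_or_phase_image\<close>). Otherwise all quaternions go to phases times quaternions, and
  additivity forces a common phase unless the rank is one (\<open>parallel_preserver_cases\<close>). A real map of
  the quaternions has a singular value decomposition in which the rotations are
  \<open>X \<mapsto> U X V\<close> with \<open>U\<close>, \<open>V\<close> in \<open>SU(2)\<close> (\<open>quaternionic_svd\<close>); so the normal form can even be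
  taken diagonal.

  A map preserving triangle equality also preserves parallelism. A nonzero map of rank one is excluded by a few
  explicit pairs. In the diagonal normal form one explicit pair forces all diagonal entries to have the same
  modulus (\<open>TEA_preserver_equal_moduli\<close>), and the remaining sign changes are unitary
  multiplications, possibly composed with transposition (\<open>sign_diagonal_form\<close>).\<close>

section \<open>Two-by-two matrices and quaternions\<close>

definition mat2 :: "complex \<Rightarrow> complex \<Rightarrow> complex \<Rightarrow> complex \<Rightarrow> complex^2^2" where
  "mat2 a b c d = vector [vector [a, b], vector [c, d]]"

lemma mat2_nth [simp]:
  "mat2 a b c d $ 1 $ 1 = a" "mat2 a b c d $ 1 $ 2 = b"
  "mat2 a b c d $ 2 $ 1 = c" "mat2 a b c d $ 2 $ 2 = d"
  by (simp_all add: mat2_def)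

lemma mat2_eta: "mat2 (A $ 1 $ 1) (A $ 1 $ 2) (A $ 2 $ 1) (A $ 2 $ 2) = A"
  by (simp add: vec_eq_iff forall_2)

lemma mat2_cases: obtains a b c d where "A = mat2 a b c d"
  by (metis mat2_eta)

lemma mat2_inject [simp]:
  "mat2 a b c d = mat2 a' b' c' d' \<longleftrightarrow> a = a' \<and> b = b' \<and> c = c' \<and> d = d'"
  by (metis mat2_nth)

lemma mat2_mult [simp]:
  "mat2 a b c d ** mat2 e f g h = mat2 (a*e + b*g) (a*f + b*h) (c*e + d*g) (c*f + d*h)"
  by (simp add: vec_eq_iff forall_2 matrix_matrix_mult_def sum_2)

lemma mat2_add [simp]: "mat2 a b c d + mat2 e f g h = mat2 (a+e) (b+f) (c+g) (d+h)"
  by (simp add: vec_eq_iff forall_2)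

lemma mat2_cscale [simp]: "z *\<^sub>M mat2 a b c d = mat2 (z*a) (z*b) (z*c) (z*d)"
  by (simp add: vec_eq_iff forall_2 cscale_def)

lemma mat2_adjoint [simp]: "adjoint_matrix (mat2 a b c d) = mat2 (cnj a) (cnj c) (cnj b) (cnj d)"
  by (simp add: vec_eq_iff forall_2 adjoint_matrix_def)

lemma mat2_transpose [simp]: "transpose (mat2 a b c d) = mat2 a c b d"
  by (simp add: vec_eq_iff forall_2 transpose_def)

lemma mat2_one: "mat 1 = mat2 1 0 0 1"
  by (simp add: vec_eq_iff forall_2 mat_def)

lemma mat2_zero: "0 = mat2 0 0 0 0"
  by (simp add: vec_eq_iff forall_2)

lemma mat2_mult_vec [simp]: "mat2 a b c d *v vector [x, y] = vector [a*x + b*y, c*x + d*y]"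
  by (simp add: vec_eq_iff forall_2 matrix_vector_mult_def sum_2)

lemma vec2_cases: obtains x y where "v = (vector [x, y] :: 'a::zero^2)"
proof
  show "v = vector [v $ 1, v $ 2]"
    by (simp add: vec_eq_iff forall_2)
qed

lemma vec2_inject [simp]: "vector [x, y] = (vector [x', y'] :: 'a::zero^2) \<longleftrightarrow> x = x' \<and> y = y'"
  by (simp add: vec_eq_iff forall_2)

lemma norm_vec2: "norm (vector [x, y] :: complex^2) = sqrt (cmod x ^ 2 + cmod y ^ 2)"
  by (simp add: norm_vec_def L2_set_def sum_2)

lemma norm_vec2_square:
  "complex_of_real (norm (vector [x, y] :: complex^2) ^ 2) = x * cnj x + y * cnj y"
  by (simp add: norm_vec2 complex_norm_square del: of_real_power)

lemma cscale_mult_left: "(z *\<^sub>M A) ** B = z *\<^sub>M (A ** B)"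
  by (simp add: vec_eq_iff matrix_matrix_mult_def cscale_def sum_distrib_left mult.assoc)

lemma cscale_mult_right: "A ** (z *\<^sub>M B) = z *\<^sub>M (A ** B)"
  by (simp add: vec_eq_iff matrix_matrix_mult_def cscale_def sum_distrib_left algebra_simps)

lemmas cscale_1 = cmat.scale_one
lemmas cscale_0 = cmat.scale_zero_left
lemmas cscale_zero = cmat.scale_zero_right
lemmas cscale_assoc = cmat.scale_scale
lemmas cscale_distrib = cmat.scale_left_distrib

lemma matrix_add_rdistrib: "(A + B :: complex^'n^'m) ** C = A ** C + B ** C"
  by (simp add: vec_eq_iff matrix_matrix_mult_def sum.distrib distrib_right)

lemma cscale_of_real: "complex_of_real r *\<^sub>M A = r *\<^sub>R A"
  by (simp add: vec_eq_iff cscale_def) (simp add: scaleR_conv_of_real)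

lemma cscale_mult_vec: "(z *\<^sub>M A) *v x = (\<chi> i. z * (A *v x) $ i)"
  by (simp add: vec_eq_iff matrix_vector_mult_def cscale_def sum_distrib_left mult.assoc)

text \<open>The matrix of the quaternion with complex coordinates \<open>p\<close> and \<open>q\<close>; the quaternions are the
  real multiples of the elements of \<open>SU(2)\<close>.\<close>

definition quat :: "complex \<Rightarrow> complex \<Rightarrow> complex^2^2" where
  "quat p q = mat2 p q (- cnj q) (cnj p)"

definition quats :: "(complex^2^2) set" where
  "quats = {quat p q | p q. True}"

definition unit_quats :: "(complex^2^2) set" where
  "unit_quats = {quat p q | p q. p * cnj p + q * cnj q = 1}"

lemma quat_in_quats [simp]: "quat p q \<in> quats"
  by (auto simp: quats_def)

lemma quat_in_unit_quats: "quat p q \<in> unit_quats \<longleftrightarrow> p * cnj p + q * cnj q = 1"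
  by (auto simp: unit_quats_def quat_def)

lemma quatsE: assumes "X \<in> quats" obtains p q where "X = quat p q"
  using assms by (auto simp: quats_def)

lemma unit_quats_subset: "U \<in> unit_quats \<Longrightarrow> U \<in> quats"
  by (auto simp: quats_def unit_quats_def)

lemma quat_mult: "quat p q ** quat p' q' = quat (p * p' - q * cnj q') (p * q' + q * cnj p')"
  by (simp add: quat_def algebra_simps)

lemma quat_adjoint: "adjoint_matrix (quat p q) = quat (cnj p) (- q)"
  by (simp add: quat_def)

lemma quat_add: "quat p q + quat p' q' = quat (p + p') (q + q')"
  by (simp add: quat_def)

lemma quats_mult: "X \<in> quats \<Longrightarrow> Y \<in> quats \<Longrightarrow> X ** Y \<in> quats"
  by (auto simp: quat_mult elim!: quatsE)

lemma quats_add: "X \<in> quats \<Longrightarrow> Y \<in> quats \<Longrightarrow> X + Y \<in> quats"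
  by (auto simp: quat_add elim!: quatsE)

lemma quats_scaleR: "X \<in> quats \<Longrightarrow> of_real r *\<^sub>M X \<in> quats"
  by (auto simp: quat_def quats_def)

lemma unit_quats_adjoint: "U \<in> unit_quats \<Longrightarrow> adjoint_matrix U \<in> unit_quats"
  unfolding unit_quats_def by (force simp: quat_adjoint algebra_simps)

lemma unit_quats_mult: "U \<in> unit_quats \<Longrightarrow> V \<in> unit_quats \<Longrightarrow> U ** V \<in> unit_quats"
proof -
  assume "U \<in> unit_quats" "V \<in> unit_quats"
  then obtain p q p' q' where "U = quat p q" "V = quat p' q'"
    "p * cnj p + q * cnj q = 1" "p' * cnj p' + q' * cnj q' = 1"
    by (auto simp: unit_quats_def)
  moreover have "(p * p' - q * cnj q') * cnj (p * p' - q * cnj q')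
    + (p * q' + q * cnj p') * cnj (p * q' + q * cnj p')
    = (p * cnj p + q * cnj q) * (p' * cnj p' + q' * cnj q')"
    by (simp add: algebra_simps)
  ultimately show ?thesis
    by (simp only: quat_mult quat_in_unit_quats mult_1)
qed

lemma unit_quats_one: "mat 1 \<in> unit_quats"
proof -
  have "mat 1 = quat 1 0" by (simp add: quat_def mat2_one)
  then show ?thesis unfolding unit_quats_def by (force)
qed

lemma unit_quats_unitary: "U \<in> unit_quats \<Longrightarrow> unitary_matrix U"
  by (auto simp: unit_quats_def unitary_matrix_def quat_def mat2_one algebra_simps)

lemma unitary_adjoint: "unitary_matrix U \<Longrightarrow> unitary_matrix (adjoint_matrix U)"
proof -
  have "adjoint_matrix (adjoint_matrix U) = U"
    by (simp add: vec_eq_iff adjoint_matrix_def)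
  then show "unitary_matrix U \<Longrightarrow> ?thesis"
    by (simp add: unitary_matrix_def)
qed

lemma unitary_cancel:
  assumes "unitary_matrix U"
  shows "adjoint_matrix U ** (U ** A) = A" "U ** (adjoint_matrix U ** A) = A"
    "A ** adjoint_matrix U ** U = A" "A ** U ** adjoint_matrix U = A"
  using assms unfolding unitary_matrix_def
  by (simp_all add: matrix_mul_assoc) (simp_all add: matrix_mul_assoc[symmetric])

lemma unitary_undo:
  fixes A U V :: "complex^'n^'n"
  assumes "unitary_matrix U" "unitary_matrix V"
  shows "adjoint_matrix U ** (U ** A ** V) ** adjoint_matrix V = A"
  using unitary_cancel[OF assms(1)] unitary_cancel[OF assms(2)] by (simp add: matrix_mul_assoc)

section \<open>The spectral norm\<close>

lemma norm_le_spectral: "norm (A *v x) \<le> spectral_norm A * norm x"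
  unfolding spectral_norm_def by (rule onorm[OF bounded_linear_cmatrix_vector_mult])

lemma spectral_norm_le:
  assumes "\<And>x. norm x = 1 \<Longrightarrow> norm (A *v x) \<le> c"
  shows "spectral_norm A \<le> c"
  using spectral_norm_max(1)[of A] assms by metis

lemma spectral_norm_nonneg: "0 \<le> spectral_norm A"
  unfolding spectral_norm_def by (rule onorm_pos_le[OF bounded_linear_cmatrix_vector_mult])

text \<open>The four coefficients after expanding \<open>(norm (U x))\<^sup>2\<close> are the entries of \<open>U\<^sup>* U\<close>.\<close>

lemma norm_unitary:
  fixes U :: "complex^2^2"
  assumes "unitary_matrix U"
  shows "norm (U *v x) = norm x"
proof -
  obtain a b c d where U: "U = mat2 a b c d" by (rule mat2_cases)
  obtain y z where x: "x = vector [y, z]" by (rule vec2_cases)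
  have *: "cnj a * a + cnj c * c = 1" "cnj a * b + cnj c * d = 0"
    "cnj b * a + cnj d * c = 0" "cnj b * b + cnj d * d = 1"
    using assms by (auto simp: U unitary_matrix_def mat2_one)
  have "complex_of_real (norm (U *v x) ^ 2)
    = (cnj a * a + cnj c * c) * (y * cnj y) + (cnj a * b + cnj c * d) * (z * cnj y)
      + (cnj b * a + cnj d * c) * (y * cnj z) + (cnj b * b + cnj d * d) * (z * cnj z)"
    unfolding U x mat2_mult_vec norm_vec2_square by (simp add: algebra_simps)
  also have "\<dots> = complex_of_real (norm x ^ 2)"
    unfolding * x norm_vec2_square by simp
  finally show ?thesis
    by (simp only: of_real_eq_iff) simp
qed

lemma spectral_norm_unitary:
  fixes A :: "complex^2^2"
  assumes U: "unitary_matrix U" and V: "unitary_matrix V"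
  shows "spectral_norm (U ** A ** V) = spectral_norm A"
proof -
  have le: "spectral_norm (U ** A ** V) \<le> spectral_norm A"
    if "unitary_matrix U" "unitary_matrix V" for U V A :: "complex^2^2"
  proof (rule spectral_norm_le)
    fix x :: "complex^2" assume "norm x = 1"
    have "norm (U ** A ** V *v x) = norm (A *v (V *v x))"
      using norm_unitary[OF that(1)] by (simp flip: matrix_vector_mul_assoc)
    also have "\<dots> \<le> spectral_norm A"
      by (rule spectral_norm_max) (simp add: norm_unitary[OF that(2)] \<open>norm x = 1\<close>)
    finally show "norm (U ** A ** V *v x) \<le> spectral_norm A" .
  qed
  have "adjoint_matrix U ** (U ** A ** V) ** adjoint_matrix V = A"
    by (rule unitary_undo[OF U V])
  with le[OF U V, of A] le[OF unitary_adjoint[OF U] unitary_adjoint[OF V], of "U ** A ** V"]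
  show ?thesis by simp
qed

lemma spectral_norm_cscale: "spectral_norm (z *\<^sub>M A) = cmod z * spectral_norm A"
proof -
  have n: "norm ((z *\<^sub>M A) *v x) = cmod z * norm (A *v x)" for x
    by (simp add: cscale_mult_vec norm_vec_def norm_mult L2_set_def power_mult_distrib
        real_sqrt_mult flip: sum_distrib_left)
  obtain x y where x: "norm x = 1" "norm (A *v x) = spectral_norm A"
    and y: "norm y = 1" "norm ((z *\<^sub>M A) *v y) = spectral_norm (z *\<^sub>M A)"
    using spectral_norm_max(1) by metis
  have "spectral_norm (z *\<^sub>M A) \<le> cmod z * spectral_norm A"
    using spectral_norm_max(2)[OF y(1), of A] y(2) by (metis n mult_left_mono norm_ge_zero)
  moreover have "cmod z * spectral_norm A \<le> spectral_norm (z *\<^sub>M A)"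
    using spectral_norm_max(2)[OF x(1), of "z *\<^sub>M A"] x(2) by (metis n)
  ultimately show ?thesis by simp
qed

lemma spectral_norm_diag: "spectral_norm (mat2 a 0 0 d) = max (cmod a) (cmod d)"
proof (rule antisym)
  let ?m = "max (cmod a) (cmod d)"
  show "spectral_norm (mat2 a 0 0 d) \<le> ?m"
  proof (rule spectral_norm_le)
    fix v :: "complex^2" assume v: "norm v = 1"
    obtain x y where xy: "v = vector [x, y]" by (rule vec2_cases)
    have "(cmod a * cmod x)\<^sup>2 \<le> (?m * cmod x)\<^sup>2" "(cmod d * cmod y)\<^sup>2 \<le> (?m * cmod y)\<^sup>2"
      by (intro power_mono mult_right_mono; simp)+
    then have "norm (mat2 a 0 0 d *v v) \<le> sqrt (?m\<^sup>2 * ((cmod x)\<^sup>2 + (cmod y)\<^sup>2))"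
      by (simp add: xy norm_vec2 norm_mult power_mult_distrib distrib_left)
    also have "\<dots> = ?m" using v
      by (simp add: real_sqrt_mult xy norm_vec2) (simp add: max_def)
    finally show "norm (mat2 a 0 0 d *v v) \<le> ?m" .
  qed
  show "?m \<le> spectral_norm (mat2 a 0 0 d)"
    using norm_le_spectral[of "mat2 a 0 0 d" "vector [1, 0]"]
      norm_le_spectral[of "mat2 a 0 0 d" "vector [0, 1]"]
    by (simp add: norm_vec2)
qed

text \<open>If the norm is attained by the corner entry, that entry exhausts both its column and its row: testing with
  the first unit vector gives the column, and testing with the conjugated first row gives the row.\<close>

lemma attained_at_corner:
  assumes "spectral_norm (mat2 a b c d) \<le> cmod a"
  shows "b = 0" "c = 0" "cmod d \<le> cmod a"
proof -
  let ?A = "mat2 a b c d"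
  have col1: "sqrt ((cmod a)\<^sup>2 + (cmod c)\<^sup>2) \<le> cmod a"
    using norm_le_spectral[of ?A "vector [1, 0]"] assms by (simp add: norm_vec2)
  then have "(sqrt ((cmod a)\<^sup>2 + (cmod c)\<^sup>2))\<^sup>2 \<le> (cmod a)\<^sup>2"
    by (intro power_mono) auto
  then show c: "c = 0" by simp
  have "sqrt ((cmod b)\<^sup>2 + (cmod d)\<^sup>2) \<le> cmod a"
    using norm_le_spectral[of ?A "vector [0, 1]"] assms by (simp add: norm_vec2)
  moreover have "cmod d \<le> sqrt ((cmod b)\<^sup>2 + (cmod d)\<^sup>2)"
    by (rule real_le_rsqrt) simp
  ultimately show "cmod d \<le> cmod a" by linarith
  define r where "r = sqrt ((cmod a)\<^sup>2 + (cmod b)\<^sup>2)"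
  have r2: "complex_of_real (r^2) = a * cnj a + b * cnj b"
    by (simp add: r_def complex_norm_square del: of_real_power)
  have "r\<^sup>2 = cmod (a * cnj a + b * cnj b)"
    unfolding r2[symmetric] by (simp only: norm_of_real abs_power2)
  also have "\<dots> \<le> norm (?A *v vector [cnj a, cnj b])"
    by (simp add: norm_vec2 c)
  also have "\<dots> \<le> spectral_norm ?A * r"
    using norm_le_spectral[of ?A "vector [cnj a, cnj b]"] by (simp add: norm_vec2 r_def)
  also have "\<dots> \<le> cmod a * r"
    by (intro mult_right_mono assms) (simp add: r_def)
  finally have "r * r \<le> cmod a * r" by (simp add: power2_eq_square)
  moreover have "0 \<le> r" by (simp add: r_def)
  ultimately have "r \<le> cmod a"
    by (cases "r = 0") (simp_all add: mult_le_cancel_right)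
  then have "r\<^sup>2 \<le> (cmod a)\<^sup>2"
    by (intro power_mono) (auto simp: r_def)
  then show "b = 0" by (simp add: r_def)
qed

section \<open>Simultaneous diagonal form of pairs\<close>

lemma TEA_unitary:
  fixes A B :: "complex^2^2"
  assumes "unitary_matrix U" "unitary_matrix V"
  shows "TEA (U ** A ** V) (U ** B ** V) \<longleftrightarrow> TEA A B"
proof -
  have "U ** A ** V + U ** B ** V = U ** (A + B) ** V"
    by (simp add: matrix_add_ldistrib matrix_add_rdistrib)
  then show ?thesis
    by (simp add: TEA_def spectral_norm_unitary[OF assms])
qed

lemma parallel_iff_TEA: "parallel A B \<longleftrightarrow> (\<exists>\<mu>. cmod \<mu> = 1 \<and> TEA A (\<mu> *\<^sub>M B))"
  by (simp add: parallel_def TEA_def spectral_norm_cscale cong: conj_cong)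

lemma parallel_unitary:
  fixes A B :: "complex^2^2"
  assumes "unitary_matrix U" "unitary_matrix V"
  shows "parallel (U ** A ** V) (U ** B ** V) \<longleftrightarrow> parallel A B"
proof -
  have "\<mu> *\<^sub>M (U ** B ** V) = U ** (\<mu> *\<^sub>M B) ** V" for \<mu>
    by (simp only: cscale_mult_left cscale_mult_right)
  then show ?thesis
    unfolding parallel_iff_TEA by (simp only: TEA_unitary[OF assms])
qed

text \<open>Equality in \<open>norm (A v + B v) \<le> norm (A v) + norm (B v)\<close> at a vector \<open>v\<close> where \<open>A + B\<close> attains its
  norm forces both matrices to attain their norms at \<open>v\<close>, in the same direction \<open>w\<close>.
  Completing \<open>v\<close> and \<open>w\<close> to orthonormal bases puts the two norms into the corners, and
  \<open>attained_at_corner\<close> removes the off-diagonal entries.\<close>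

lemma TEA_diagonalize:
  fixes A B :: "complex^2^2"
  assumes "TEA A B"
  obtains U V b d where "U \<in> unit_quats" "V \<in> unit_quats"
    "U ** A ** V = mat2 (spectral_norm A) 0 0 b" "U ** B ** V = mat2 (spectral_norm B) 0 0 d"
    "cmod b \<le> spectral_norm A" "cmod d \<le> spectral_norm B"
proof -
  obtain v where v: "norm v = 1" "norm ((A + B) *v v) = spectral_norm (A + B)"
    using spectral_norm_max(1) by metis
  have "norm (A *v v + B *v v) = spectral_norm A + spectral_norm B"
    using v(2) assms by (simp add: TEA_def matrix_vector_mult_add_rdistrib)
  with spectral_norm_max(2)[OF v(1), of A] spectral_norm_max(2)[OF v(1), of B]
    norm_triangle_ineq[of "A *v v" "B *v v"]
  have nA: "norm (A *v v) = spectral_norm A" and nB: "norm (B *v v) = spectral_norm B"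
    and "norm (A *v v + B *v v) = norm (A *v v) + norm (B *v v)"
    by linarith+
  then have dep: "spectral_norm A *\<^sub>R (B *v v) = spectral_norm B *\<^sub>R (A *v v)"
    using norm_triangle_eq[of "A *v v" "B *v v"] by simp
  obtain w where w: "norm w = 1" "A *v v = spectral_norm A *\<^sub>R w" "B *v v = spectral_norm B *\<^sub>R w"
  proof (cases "spectral_norm A = 0")
    case False
    show ?thesis
    proof
      show "norm ((1 / spectral_norm A) *\<^sub>R (A *v v)) = 1"
        using False nA by (simp add: spectral_norm_nonneg)
      show "A *v v = spectral_norm A *\<^sub>R ((1 / spectral_norm A) *\<^sub>R (A *v v))"
        using False by simp
      have "B *v v = (1 / spectral_norm A) *\<^sub>R (spectral_norm A *\<^sub>R (B *v v))"
        using False by simp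
      then show "B *v v = spectral_norm B *\<^sub>R ((1 / spectral_norm A) *\<^sub>R (A *v v))"
        unfolding dep by (simp add: field_simps)
    qed
  next
    case A0: True
    then have Av: "A *v v = 0" using nA by simp
    show ?thesis
    proof (cases "spectral_norm B = 0")
      case True
      with nB have "B *v v = 0" by simp
      with Av A0 True v(1) that[of v] show ?thesis by simp
    next
      case False
      with Av A0 nB that[of "(1 / spectral_norm B) *\<^sub>R (B *v v)"] show ?thesis
        by (simp add: spectral_norm_nonneg)
    qed
  qed
  obtain x1 x2 where x: "v = vector [x1, x2]" by (rule vec2_cases)
  obtain y1 y2 where y: "w = vector [y1, y2]" by (rule vec2_cases)
  have x1: "x1 * cnj x1 + x2 * cnj x2 = 1" using norm_vec2_square[of x1 x2] v(1) x by simp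
  have y1: "y1 * cnj y1 + y2 * cnj y2 = 1" using norm_vec2_square[of y1 y2] w(1) y by simp
  \<comment> \<open>The first column of V is v and the first row of U is the adjoint of w.\<close>
  define V where "V = quat x1 (- cnj x2)"
  define U where "U = quat (cnj y1) (cnj y2)"
  have V: "V \<in> unit_quats" unfolding V_def unit_quats_def
    using x1 by (force simp: algebra_simps)
  have U: "U \<in> unit_quats" unfolding U_def unit_quats_def
    using y1 by (force simp: algebra_simps)
  have corner: "\<exists>d. U ** M ** V = mat2 (spectral_norm M) 0 0 d \<and> cmod d \<le> spectral_norm M"
    if M: "M *v v = spectral_norm M *\<^sub>R w" for M
  proof -
    obtain a b c d where m: "M = mat2 a b c d" by (rule mat2_cases)
    define s where "s = complex_of_real (spectral_norm M)"
    have "spectral_norm M *\<^sub>R w = vector [s * y1, s * y2]"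
      by (simp add: y vec_eq_iff forall_2 s_def) (simp add: scaleR_conv_of_real)
    then have e: "a * x1 + b * x2 = s * y1" "c * x1 + d * x2 = s * y2"
      using M by (simp_all add: m x)
    have "(U ** M ** V) $ 1 $ 1 = cnj y1 * (a * x1 + b * x2) + cnj y2 * (c * x1 + d * x2)"
      by (simp add: U_def V_def m quat_def algebra_simps)
    also have "\<dots> = s * (y1 * cnj y1 + y2 * cnj y2)" by (simp add: e algebra_simps)
    finally have 11: "(U ** M ** V) $ 1 $ 1 = s" by (simp add: y1)
    define E where "E = U ** M ** V"
    have nE: "spectral_norm E = spectral_norm M"
      unfolding E_def by (intro spectral_norm_unitary unit_quats_unitary U V)
    have Em: "E = mat2 s (E $ 1 $ 2) (E $ 2 $ 1) (E $ 2 $ 2)"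
      using mat2_eta[of E] 11 by (simp add: E_def)
    have cs: "cmod s = spectral_norm E"
      by (simp add: nE s_def spectral_norm_nonneg)
    have "E $ 1 $ 2 = 0" "E $ 2 $ 1 = 0" "cmod (E $ 2 $ 2) \<le> cmod s"
      using Em cs attained_at_corner[of s "E $ 1 $ 2" "E $ 2 $ 1" "E $ 2 $ 2"] by simp_all
    with Em cs nE show ?thesis
      unfolding E_def s_def by metis
  qed
  from corner[OF w(2)] corner[OF w(3)] that[OF U V] show ?thesis by blast
qed

text \<open>The singular value decomposition, as the case of a matrix paired with zero.\<close>

lemma singular_values:
  fixes A :: "complex^2^2"
  obtains U V a b where "U \<in> unit_quats" "V \<in> unit_quats" "U ** A ** V = mat2 a 0 0 b"
    "cmod b \<le> cmod a"
proof -
  have "TEA A 0"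
    using spectral_norm_diag[of 0 0] by (simp add: TEA_def flip: mat2_zero)
  then obtain U V b d where "U \<in> unit_quats" "V \<in> unit_quats"
    "U ** A ** V = mat2 (spectral_norm A) 0 0 b" "cmod b \<le> spectral_norm A"
    by (rule TEA_diagonalize)
  with that[of U V "complex_of_real (spectral_norm A)" b] show ?thesis
    by (simp add: spectral_norm_nonneg)
qed

lemma TEA_diagI:
  assumes "0 \<le> a" "0 \<le> c" "cmod b \<le> a" "cmod d \<le> c"
  shows "TEA (mat2 (complex_of_real a) 0 0 b) (mat2 (complex_of_real c) 0 0 d)"
proof -
  have "cmod (b + d) \<le> a + c" using assms norm_triangle_ineq[of b d] by linarith
  moreover have "cmod (complex_of_real a + complex_of_real c) = a + c"
    using assms by (simp flip: of_real_add)
  ultimately show ?thesis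
    using assms by (simp add: TEA_def spectral_norm_diag max_def)
qed

lemma phase_exists: obtains \<mu> where "cmod \<mu> = 1" "cmod (a + \<mu> * c) = cmod a + cmod c"
proof (cases "a = 0 \<or> c = 0")
  case True
  then show ?thesis using that[of 1] by auto
next
  case False
  define \<mu> where "\<mu> = (a / cmod a) * (cmod c / c)"
  have "\<mu> * c = a * of_real (cmod c / cmod a)" using False by (simp add: \<mu>_def)
  then have "a + \<mu> * c = a * of_real (1 + cmod c / cmod a)"
    by (simp add: algebra_simps)
  then have "cmod (a + \<mu> * c) = cmod a * (1 + cmod c / cmod a)"
    by (simp only: norm_mult norm_of_real) (simp add: add_nonneg_nonneg)
  then have "cmod (a + \<mu> * c) = cmod a + cmod c" using False by (simp add: field_simps)
  moreover have "cmod \<mu> = 1" using False by (simp add: \<mu>_def norm_mult norm_divide)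
  ultimately show ?thesis using that by blast
qed

lemma parallel_diagI1:
  assumes "cmod b \<le> cmod a" "cmod d \<le> cmod c"
  shows "parallel (mat2 a 0 0 b) (mat2 c 0 0 d)"
proof -
  obtain \<mu> where \<mu>: "cmod \<mu> = 1" "cmod (a + \<mu> * c) = cmod a + cmod c" by (rule phase_exists)
  have "cmod (b + \<mu> * d) \<le> cmod b + cmod d"
    using norm_triangle_ineq[of b "\<mu> * d"] \<mu>(1) by (simp add: norm_mult)
  then have "cmod (b + \<mu> * d) \<le> cmod a + cmod c" using assms by linarith
  then show ?thesis unfolding parallel_def
    using assms \<mu> by (intro exI[of _ \<mu>]) (simp add: spectral_norm_diag max_def)
qed

abbreviation (input) "flip2 \<equiv> mat2 0 1 1 0"

lemma flip2_unitary: "unitary_matrix flip2"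
  by (simp add: unitary_matrix_def mat2_one)

lemma parallel_diag_flip:
  "parallel (mat2 b 0 0 a) (mat2 d 0 0 c) \<longleftrightarrow> parallel (mat2 a 0 0 b) (mat2 c 0 0 d)"
  using parallel_unitary[OF flip2_unitary flip2_unitary, of "mat2 a 0 0 b" "mat2 c 0 0 d"]
  by simp

lemma parallel_diagI2:
  assumes "cmod a \<le> cmod b" "cmod c \<le> cmod d"
  shows "parallel (mat2 a 0 0 b) (mat2 c 0 0 d)"
  using parallel_diagI1[OF assms] parallel_diag_flip by blast

lemma parallel_diagonalize:
  fixes A B :: "complex^2^2"
  assumes "parallel A B"
  obtains U V a b c d where "U \<in> unit_quats" "V \<in> unit_quats"
    "U ** A ** V = mat2 a 0 0 b" "U ** B ** V = mat2 c 0 0 d"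
    "cmod b \<le> cmod a" "cmod d \<le> cmod c"
proof -
  obtain \<mu> where \<mu>: "cmod \<mu> = 1" "TEA A (\<mu> *\<^sub>M B)" using assms by (auto simp: parallel_iff_TEA)
  obtain U V b d where UV: "U \<in> unit_quats" "V \<in> unit_quats"
    "U ** A ** V = mat2 (spectral_norm A) 0 0 b"
    "U ** (\<mu> *\<^sub>M B) ** V = mat2 (spectral_norm (\<mu> *\<^sub>M B)) 0 0 d"
    "cmod b \<le> spectral_norm A" "cmod d \<le> spectral_norm (\<mu> *\<^sub>M B)"
    by (rule TEA_diagonalize[OF \<mu>(2)])
  have \<mu>0: "\<mu> \<noteq> 0" using \<mu>(1) by auto
  have "U ** B ** V = inverse \<mu> *\<^sub>M (U ** (\<mu> *\<^sub>M B) ** V)"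
    using \<mu>0 by (simp add: cscale_mult_left cscale_mult_right)
  also have "\<dots> = mat2 (inverse \<mu> * spectral_norm (\<mu> *\<^sub>M B)) 0 0 (inverse \<mu> * d)"
    by (simp add: UV(4))
  finally show ?thesis
    using that[OF UV(1,2,3)] UV(5,6) \<mu>(1)
    by (simp add: norm_mult norm_inverse spectral_norm_nonneg)
qed

text \<open>Distinct singular values determine the direction in which the norm is attained: here it
  is the first unit vector up to a phase, so a parallel matrix must attain its norm there as well.\<close>

lemma parallel_diagD:
  assumes "parallel (mat2 a 0 0 b) M" "cmod b < cmod a"
  obtains c d where "M = mat2 c 0 0 d" "cmod d \<le> cmod c"
proof -
  obtain \<mu> where \<mu>: "cmod \<mu> = 1"
    "spectral_norm (mat2 a 0 0 b + \<mu> *\<^sub>M M) = spectral_norm (mat2 a 0 0 b) + spectral_norm M"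
    using assms(1) by (auto simp: parallel_def)
  obtain c e f d where M: "M = mat2 c e f d" by (rule mat2_cases)
  define N where "N = mat2 a 0 0 b + \<mu> *\<^sub>M M"
  obtain v where v: "norm v = 1" "norm (N *v v) = spectral_norm N"
    using spectral_norm_max(1) by metis
  obtain x y where xy: "v = vector [x, y]" by (rule vec2_cases)
  \<comment> \<open>The vector at which the sum attains its norm also maximizes the given diagonal matrix, so y vanishes.\<close>
  have nxy: "(cmod x)\<^sup>2 + (cmod y)\<^sup>2 = 1" using v(1) by (simp add: xy norm_vec2)
  have N: "spectral_norm N = cmod a + spectral_norm M"
    using \<mu>(2) assms(2) by (simp add: N_def spectral_norm_diag)
  have nM: "norm ((\<mu> *\<^sub>M M) *v v) \<le> spectral_norm M"
    using spectral_norm_max(2)[OF v(1), of "\<mu> *\<^sub>M M"] \<mu>(1) by (simp add: spectral_norm_cscale)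
  have "norm (N *v v) \<le> norm (mat2 a 0 0 b *v v) + norm ((\<mu> *\<^sub>M M) *v v)"
    unfolding N_def matrix_vector_mult_add_rdistrib by (rule norm_triangle_ineq)
  then have "cmod a \<le> norm (mat2 a 0 0 b *v v)" using nM v(2) N by linarith
  then have "(cmod a)\<^sup>2 \<le> (norm (mat2 a 0 0 b *v v))\<^sup>2" by (intro power_mono) auto
  also have "\<dots> = (cmod a)\<^sup>2 * (cmod x)\<^sup>2 + (cmod b)\<^sup>2 * (cmod y)\<^sup>2"
    by (simp add: xy norm_vec2 norm_mult power_mult_distrib)
  also have "\<dots> = (cmod a)\<^sup>2 * (1 - (cmod y)\<^sup>2) + (cmod b)\<^sup>2 * (cmod y)\<^sup>2"
    unfolding nxy[symmetric] by simp
  finally have "((cmod a)\<^sup>2 - (cmod b)\<^sup>2) * (cmod y)\<^sup>2 \<le> 0" by (simp add: algebra_simps)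
  moreover have "(cmod a)\<^sup>2 - (cmod b)\<^sup>2 > 0"
    using assms(2) by (simp add: power_strict_mono)
  ultimately have "(cmod y)\<^sup>2 \<le> 0" by (metis mult_pos_pos not_le)
  then have y0: "y = 0" by simp
  then have x1: "cmod x = 1" using nxy by (simp add: power2_eq_1_iff) (use norm_ge_zero[of x] in linarith)
  have Nv: "N *v v = mat2 a 0 0 b *v v + (\<mu> *\<^sub>M M) *v v"
    unfolding N_def by (rule matrix_vector_mult_add_rdistrib)
  let ?S = "spectral_norm M"
  have nMv: "norm (\<mu> *\<^sub>M M *v v) = sqrt ((cmod c)\<^sup>2 + (cmod f)\<^sup>2)"
    using \<mu>(1) x1 by (simp add: M xy y0 norm_vec2 norm_mult)
  have nNv: "norm (N *v v) = sqrt ((cmod (a + \<mu> * c))\<^sup>2 + (cmod f)\<^sup>2)"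
  proof -
    have "N *v v = vector [(a + \<mu> * c) * x, \<mu> * f * x]"
      unfolding Nv by (simp add: M xy y0 vec_eq_iff forall_2 algebra_simps)
    then show ?thesis using \<mu>(1) x1 by (simp add: norm_vec2 norm_mult)
  qed
  have le1: "(cmod c)\<^sup>2 + (cmod f)\<^sup>2 \<le> ?S\<^sup>2"
    using nM spectral_norm_nonneg[of M] unfolding nMv by (metis sqrt_le_D)
  have eq: "(cmod (a + \<mu> * c))\<^sup>2 + (cmod f)\<^sup>2 = (cmod a + ?S)\<^sup>2"
    using nNv v(2) N by (metis real_sqrt_pow2 sum_power2_ge_zero)
  have "cmod (a + \<mu> * c) \<le> cmod a + cmod c"
    using norm_triangle_ineq[of a "\<mu> * c"] \<mu>(1) by (simp add: norm_mult)
  then have "(cmod (a + \<mu> * c))\<^sup>2 \<le> (cmod a + cmod c)\<^sup>2" by (intro power_mono) auto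
  with eq le1 have "2 * cmod a * ?S \<le> 2 * cmod a * cmod c"
    by (simp add: power2_sum)
  then have "?S \<le> cmod c" using assms(2) norm_ge_zero[of b]
    by (metis (no_types) mult_le_cancel_left_pos mult_pos_pos order_le_less_trans zero_less_numeral)
  from attained_at_corner[OF this[unfolded M]] that show ?thesis by (simp add: M)
qed


section \<open>Quaternionic maps preserve parallelism\<close>

abbreviation clinear :: "(complex^2^2 \<Rightarrow> complex^2^2) \<Rightarrow> bool" where
  "clinear T \<equiv> Vector_Spaces.linear cscale cscale T"

lemma clinear_add: "clinear T \<Longrightarrow> T (A + B) = T A + T B"
  by (simp add: Vector_Spaces.linear_iff)

lemma clinear_scale: "clinear T \<Longrightarrow> T (c *\<^sub>M A) = c *\<^sub>M T A"
  by (simp add: Vector_Spaces.linear_iff)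

lemma clinearI:
  assumes "\<And>A B. T (A + B) = T A + T B" "\<And>c A. T (c *\<^sub>M A) = c *\<^sub>M T A"
  shows "clinear T"
  by (simp add: Vector_Spaces.linear_iff assms cmat.vector_space_axioms)

lemma clinear_unitary: "clinear T \<Longrightarrow> clinear (\<lambda>A. U1 ** T (U2 ** A ** V2) ** V1)"
  by (rule clinearI) (simp_all add: matrix_add_ldistrib matrix_add_rdistrib clinear_add
      clinear_scale cscale_mult_left cscale_mult_right)

text \<open>A quaternion \<open>P\<close> is \<open>r\<close> times a unit quaternion, with \<open>r\<^sup>2 = P P\<^sup>*\<close>, and \<open>S\<close> is the inverse of the
  latter.\<close>

lemma quat_polar:
  assumes "P \<in> quats"
  obtains S r where "S \<in> unit_quats" "S ** P = mat2 (complex_of_real r) 0 0 (complex_of_real r)" "0 \<le> r"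
proof -
  obtain p q where P: "P = quat p q" using assms by (rule quatsE)
  define r where "r = sqrt ((cmod p)\<^sup>2 + (cmod q)\<^sup>2)"
  have r2: "p * cnj p + q * cnj q = complex_of_real (r^2)"
    by (simp add: r_def complex_norm_square del: of_real_power)
  show ?thesis
  proof (cases "r = 0")
    case True
    then have "p = 0" "q = 0" by (simp_all add: r_def add_nonneg_eq_0_iff)
    then show ?thesis using that[of "mat 1" 0]
      by (simp add: unit_quats_one P quat_def)
  next
    case False
    define S where "S = quat (cnj p / r) (- q / r)"
    have "S \<in> unit_quats" unfolding S_def quat_in_unit_quats
      using r2 False by (simp add: field_simps power2_eq_square)
    moreover have "S ** P = mat2 r 0 0 r"
      using r2 False by (simp add: S_def P quat_def field_simps power2_eq_square)
    moreover have "0 \<le> r" by (simp add: r_def)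
    ultimately show ?thesis using that by blast
  qed
qed

text \<open>An eigenvector of \<open>Q\<close> completed to an element of \<open>SU(2)\<close> triangularizes \<open>Q\<close>, and a triangular
  quaternion is diagonal with conjugate entries.\<close>

lemma quat_diagonalize:
  assumes "Q \<in> quats"
  obtains W z where "W \<in> unit_quats" "W ** Q ** adjoint_matrix W = mat2 z 0 0 (cnj z)"
proof -
  obtain p q where Q: "Q = quat p q" using assms by (rule quatsE)
  show ?thesis
  proof (cases "q = 0")
    case True
    have "adjoint_matrix (mat 1) = (mat 1 :: complex^2^2)" by (simp add: mat2_one)
    then show ?thesis
      using that[of "mat 1" p] True by (simp add: unit_quats_one Q quat_def)
  next
    case False
    define s where "s = sqrt ((Im p)\<^sup>2 + (cmod q)\<^sup>2)"
    have s2: "s\<^sup>2 = (Im p)\<^sup>2 + (cmod q)\<^sup>2" by (simp add: s_def)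
    \<comment> \<open>l is an eigenvalue, a root of X^2 - 2 (Re p) X + |p|^2 + |q|^2, with eigenvector (q, l - p).\<close>
    define l where "l = Complex (Re p) s"
    have qq: "q * cnj q = complex_of_real ((cmod q)\<^sup>2)" by (simp add: complex_norm_square del: of_real_power)
    have char: "- cnj q * q + cnj p * (l - p) = l * (l - p)"
      unfolding complex_eq_iff using s2 qq
      by (simp add: l_def algebra_simps power2_eq_square complex_eq_iff cmod_power2[unfolded power2_eq_square])
    define n where "n = sqrt ((cmod q)\<^sup>2 + (cmod (l - p))\<^sup>2)"
    have n0: "n \<noteq> 0" using False by (simp add: n_def add_nonneg_eq_0_iff)
    have n2: "q * cnj q + (l - p) * cnj (l - p) = complex_of_real (n^2)"
      by (simp add: n_def complex_norm_square del: of_real_power complex_cnj_diff)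
    define x y where "x = q / n" and "y = (l - p) / n"
    have xy: "x * cnj x + y * cnj y = 1"
      using n2 n0 unfolding x_def y_def by (simp add: field_simps power2_eq_square)
    have e1: "p * x + q * y = l * x" by (simp add: x_def y_def field_simps n0)
    have e2: "- cnj q * x + cnj p * y = l * y"
    proof -
      have "- cnj q * x + cnj p * y = (- cnj q * q + cnj p * (l - p)) / n"
        by (simp only: x_def y_def add_divide_distrib times_divide_eq_right)
      then show ?thesis by (simp only: char y_def times_divide_eq_right)
    qed
    define W where "W = quat (cnj x) (cnj y)"
    have W: "W \<in> unit_quats" unfolding W_def quat_in_unit_quats using xy by (simp add: algebra_simps)
    define E where "E = W ** Q ** adjoint_matrix W"
    have "E \<in> quats" unfolding E_def
      by (intro quats_mult assms unit_quats_subset W unit_quats_adjoint)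
    then obtain z c where E: "E = quat z c" by (rule quatsE)
    have "E $ 2 $ 1 = x * (- cnj q * x + cnj p * y) - y * (p * x + q * y)"
      by (simp add: E_def W_def Q quat_def algebra_simps)
    also have "\<dots> = 0" by (simp only: e1 e2) simp
    finally have "c = 0" by (simp add: E quat_def)
    then show ?thesis using that[OF W, of z] by (simp add: E_def[symmetric] E quat_def)
  qed
qed

text \<open>Make \<open>P\<close> scalar by its polar form; conjugating by a unitary that diagonalizes what \<open>Q\<close> has become
  leaves the scalar unchanged.\<close>

lemma pencil_diagonalize:
  assumes "P \<in> quats" "Q \<in> quats"
  obtains S R r z where "S \<in> unit_quats" "R \<in> unit_quats" "0 \<le> r"
    "S ** P ** R = mat2 (complex_of_real r) 0 0 (complex_of_real r)"
    "S ** Q ** R = mat2 z 0 0 (cnj z)"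
proof -
  obtain S r where S: "S \<in> unit_quats" "S ** P = mat2 (complex_of_real r) 0 0 (complex_of_real r)" "0 \<le> r"
    using quat_polar[OF assms(1)] .
  obtain W z where W: "W \<in> unit_quats" "W ** (S ** Q) ** adjoint_matrix W = mat2 z 0 0 (cnj z)"
    using quat_diagonalize[OF quats_mult[OF unit_quats_subset[OF S(1)] assms(2)]] .
  have rI: "mat2 (complex_of_real r) 0 0 (complex_of_real r) = complex_of_real r *\<^sub>M mat 1"
    by (simp add: mat2_one)
  have "W ** (S ** P) ** adjoint_matrix W = mat2 (complex_of_real r) 0 0 (complex_of_real r)"
    unfolding S(2) rI cscale_mult_left cscale_mult_right
    using unit_quats_unitary[OF W(1)] by (simp add: unitary_matrix_def)
  with W(2) that[OF unit_quats_mult[OF W(1) S(1)] unit_quats_adjoint[OF W(1)] S(3)]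
  show ?thesis by (simp add: matrix_mul_assoc)
qed

text \<open>The sign of \<open>Im (p * cnj q)\<close> is the orientation of \<open>p P + q Q\<close> in the plane spanned by \<open>P\<close> and \<open>Q\<close>.
  After diagonalizing the pencil, the difference of the squared moduli of the two diagonal entries is this
  number times a factor depending only on \<open>P\<close> and \<open>Q\<close>; so the same entry dominates for both
  combinations.\<close>

lemma pencil_parallel:
  assumes "P \<in> quats" "Q \<in> quats" "0 \<le> Im (p * cnj q)" "0 \<le> Im (p' * cnj q')"
  shows "parallel (p *\<^sub>M P + q *\<^sub>M Q) (p' *\<^sub>M P + q' *\<^sub>M Q)"
proof -
  obtain S R r z where SR: "S \<in> unit_quats" "R \<in> unit_quats" "0 \<le> r"
    "S ** P ** R = mat2 (complex_of_real r) 0 0 (complex_of_real r)"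
    "S ** Q ** R = mat2 z 0 0 (cnj z)"
    using pencil_diagonalize[OF assms(1,2)] .
  have img: "S ** (p *\<^sub>M P + q *\<^sub>M Q) ** R = mat2 (p * r + q * z) 0 0 (p * r + q * cnj z)" for p q
    by (simp add: matrix_add_ldistrib matrix_add_rdistrib cscale_mult_left cscale_mult_right SR)
  have diff: "(cmod (p * r + q * z))\<^sup>2 - (cmod (p * r + q * cnj z))\<^sup>2 = 4 * r * Im z * Im (p * cnj q)"
    for p q :: complex
    unfolding cmod_power2 by (simp add: power2_eq_square algebra_simps)
  have "parallel (mat2 (p * r + q * z) 0 0 (p * r + q * cnj z))
    (mat2 (p' * r + q' * z) 0 0 (p' * r + q' * cnj z))"
  proof (cases "0 \<le> Im z")
    case True
    have le: "cmod (p * r + q * cnj z) \<le> cmod (p * r + q * z)" if "0 \<le> Im (p * cnj q)" for p q :: complex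
    proof (rule power2_le_imp_le)
      have "0 \<le> r * Im z * Im (p * cnj q)" using True SR(3) that by (intro mult_nonneg_nonneg)
      with diff[of p q] show "(cmod (p * r + q * cnj z))\<^sup>2 \<le> (cmod (p * r + q * z))\<^sup>2" by linarith
    qed simp
    then show ?thesis by (intro parallel_diagI1 le assms)
  next
    case False
    have le: "cmod (p * r + q * z) \<le> cmod (p * r + q * cnj z)" if "0 \<le> Im (p * cnj q)" for p q :: complex
    proof (rule power2_le_imp_le)
      have "r * Im z \<le> 0" using False SR(3) by (intro mult_nonneg_nonpos) auto
      then have "r * Im z * Im (p * cnj q) \<le> 0" using that by (rule mult_nonpos_nonneg)
      with diff[of p q] show "(cmod (p * r + q * z))\<^sup>2 \<le> (cmod (p * r + q * cnj z))\<^sup>2" by linarith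
    qed simp
    then show ?thesis by (intro parallel_diagI2 le assms)
  qed
  then have "parallel (S ** (p *\<^sub>M P + q *\<^sub>M Q) ** R) (S ** (p' *\<^sub>M P + q' *\<^sub>M Q) ** R)"
    by (simp only: img)
  then show ?thesis
    by (simp only: parallel_unitary[OF unit_quats_unitary[OF SR(1)] unit_quats_unitary[OF SR(2)]])
qed

text \<open>Diagonal matrices are the complex span of the quaternions \<open>1\<close> and \<open>quat \<i> 0\<close>, and dominance
  of the first entry is the orientation condition of \<open>pencil_parallel\<close>. Applying \<open>T\<close> keeps the
  coefficients and replaces the two spanning quaternions by other quaternions.\<close>

lemma quaternionic_preserves_parallel:
  assumes T: "clinear T" and Tq: "\<And>X. X \<in> quats \<Longrightarrow> T X \<in> quats"
  shows "preserves_parallel T"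
  unfolding preserves_parallel_def
proof (intro allI impI)
  fix A B :: "complex^2^2" assume "parallel A B"
  then obtain U V a b c d where UV: "U \<in> unit_quats" "V \<in> unit_quats"
    and A: "U ** A ** V = mat2 a 0 0 b" and B: "U ** B ** V = mat2 c 0 0 d"
    and ab: "cmod b \<le> cmod a" and cd: "cmod d \<le> cmod c"
    by (rule parallel_diagonalize)
  define P where "P = adjoint_matrix U ** quat 1 0 ** adjoint_matrix V"
  define Q where "Q = adjoint_matrix U ** quat \<i> 0 ** adjoint_matrix V"
  have PQ: "P \<in> quats" "Q \<in> quats" unfolding P_def Q_def
    by (intro quats_mult unit_quats_subset[OF unit_quats_adjoint] UV quat_in_quats)+
  have dec: "M = ((a + b) / 2) *\<^sub>M P + (- (\<i> * (a - b) / 2)) *\<^sub>M Q"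
    if M: "U ** M ** V = mat2 a 0 0 b" for M a b
  proof -
    have "M = adjoint_matrix U ** (U ** M ** V) ** adjoint_matrix V"
      by (rule unitary_undo[symmetric, OF unit_quats_unitary[OF UV(1)] unit_quats_unitary[OF UV(2)]])
    also have "U ** M ** V = ((a + b) / 2) *\<^sub>M quat 1 0 + (- (\<i> * (a - b) / 2)) *\<^sub>M quat \<i> 0"
      unfolding M by (simp add: quat_def field_simps)
    finally show ?thesis
      unfolding P_def Q_def by (simp only: matrix_add_ldistrib matrix_add_rdistrib cscale_mult_left cscale_mult_right)
  qed
  have sgn: "0 \<le> Im (((a + b) / 2) * cnj (- (\<i> * (a - b) / 2)))" if "cmod b \<le> cmod a" for a b
  proof -
    have "(cmod b)\<^sup>2 \<le> (cmod a)\<^sup>2" using that by (intro power_mono) auto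
    moreover have "Im (((a + b) / 2) * cnj (- (\<i> * (a - b) / 2))) = ((cmod a)\<^sup>2 - (cmod b)\<^sup>2) / 4"
      unfolding cmod_power2 by (simp add: power2_eq_square field_simps)
    ultimately show ?thesis by (simp only:) simp
  qed
  show "parallel (T A) (T B)"
    unfolding dec[OF A] dec[OF B] clinear_add[OF T] clinear_scale[OF T]
    by (intro pencil_parallel Tq PQ sgn ab cd)
qed

section \<open>Images of quaternions under a preserver\<close>

text \<open>The complex multiples of quaternions; equivalently, the complex multiples of unitary matrices.\<close>

definition phase_quats :: "(complex^2^2) set" where
  "phase_quats = {z *\<^sub>M X | z X. X \<in> quats}"

text \<open>The matrices are the complexification of the quaternions.\<close>

lemma quat_parts:
  obtains X Y where "X \<in> quats" "Y \<in> quats" "A = X + \<i> *\<^sub>M Y"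
proof -
  obtain a b c d where A: "A = mat2 a b c d" by (rule mat2_cases)
  have "A = quat ((a + cnj d) / 2) ((b - cnj c) / 2)
    + \<i> *\<^sub>M quat ((a - cnj d) / (2 * \<i>)) ((b + cnj c) / (2 * \<i>))"
    by (simp add: A quat_def field_simps)
  then show ?thesis using that quat_in_quats by blast
qed

lemma quat_parts_unique:
  assumes "X \<in> quats" "Y \<in> quats" "X' \<in> quats" "Y' \<in> quats" "X + \<i> *\<^sub>M Y = X' + \<i> *\<^sub>M Y'"
  shows "X = X'" "Y = Y'"
proof -
  obtain p q r s p' q' r' s' where
    *: "X = quat p q" "Y = quat r s" "X' = quat p' q'" "Y' = quat r' s'"
    using assms(1-4) by (auto elim!: quatsE)
  have "p = p' \<and> r = r' \<and> q = q' \<and> s = s'"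
    using assms(5) unfolding * quat_def by (auto simp: complex_eq_iff)
  then show "X = X'" "Y = Y'" by (simp_all add: *)
qed

text \<open>With \<open>z\<^sup>2 = b / cnj a\<close>, of modulus one, dividing by \<open>z\<close> makes the diagonal entries conjugate to
  each other.\<close>

lemma diag_equal_modulus:
  assumes "cmod a = cmod b"
  shows "mat2 a 0 0 b \<in> phase_quats"
proof (cases "a = 0")
  case True
  then have "mat2 a 0 0 b = 1 *\<^sub>M quat 0 0" using assms by (simp add: quat_def)
  then show ?thesis unfolding phase_quats_def using quat_in_quats by blast
next
  case False
  define z where "z = csqrt (b / cnj a)"
  have z2: "z * z * cnj a = b" using False by (simp add: z_def flip: power2_eq_square)
  have "(cmod z)\<^sup>2 = cmod (z * z)" by (simp add: norm_mult power2_eq_square)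
  have "b \<noteq> 0" using False assms by auto
  then have "cmod (z * z) = 1" using False assms by (simp add: z_def norm_divide flip: power2_eq_square)
  with \<open>(cmod z)\<^sup>2 = _\<close> have z1: "z * cnj z = 1" by (simp flip: complex_norm_square)
  have "mat2 a 0 0 b = z *\<^sub>M quat (cnj z * a) 0"
    using z1 z2 by (simp add: quat_def mult.assoc[symmetric])
  then show ?thesis unfolding phase_quats_def using quat_in_quats by blast
qed

lemma phase_quats_unitary:
  assumes "U \<in> unit_quats" "V \<in> unit_quats" "U ** A ** V \<in> phase_quats"
  shows "A \<in> phase_quats"
proof -
  obtain z X where zX: "X \<in> quats" "U ** A ** V = z *\<^sub>M X" using assms(3) by (auto simp: phase_quats_def)
  have "A = adjoint_matrix U ** (U ** A ** V) ** adjoint_matrix V"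
    by (rule unitary_undo[symmetric, OF unit_quats_unitary[OF assms(1)] unit_quats_unitary[OF assms(2)]])
  also have "\<dots> = z *\<^sub>M (adjoint_matrix U ** X ** adjoint_matrix V)"
    by (simp only: zX(2) cscale_mult_left cscale_mult_right)
  finally show ?thesis
    unfolding phase_quats_def
    using quats_mult unit_quats_subset[OF unit_quats_adjoint] assms(1,2) zX(1) by blast
qed

text \<open>An image outside the multiples of quaternions has distinct singular values, so in suitable bases it is
  diagonal with dominant first entry. Every quaternion is parallel to \<open>X0\<close>, so all images are
  diagonal, say with entries \<open>f\<close> and \<open>g\<close>, and \<open>\<bar>g\<bar> \<le> \<bar>f\<bar>\<close> on quaternions. If \<open>f\<close> and \<open>g\<close> are
  proportional, the rank is one. Otherwise some \<open>Z = X + \<i> Y\<close> has \<open>f Z = 0\<close> and \<open>g Z \<noteq> 0\<close>. As \<open>Z\<close> is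
  parallel to the real combinations of \<open>X\<close> and \<open>Y\<close>, also \<open>\<bar>f\<bar> \<le> \<bar>g\<bar>\<close> on these. A real combination \<open>N\<close>
  with \<open>f (X0 + \<i> N) = 0\<close> exists and contradicts the strict inequality at \<open>X0\<close>.\<close>

lemma rank_one_or_phase_image:
  assumes T: "clinear T" and par: "preserves_parallel T"
    and X0: "X0 \<in> quats" "T X0 \<notin> phase_quats"
  shows "\<exists>Z. \<forall>A. \<exists>c. T A = c *\<^sub>M Z"
proof -
  obtain U V a b where UV: "U \<in> unit_quats" "V \<in> unit_quats" "U ** T X0 ** V = mat2 a 0 0 b"
    "cmod b \<le> cmod a"
    by (rule singular_values)
  have "cmod b \<noteq> cmod a"
    using diag_equal_modulus[of a b] phase_quats_unitary[OF UV(1,2)] X0(2) UV(3) by metis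
  with UV(4) have ba: "cmod b < cmod a" by simp
  then have a0: "a \<noteq> 0" by auto
  define f where "f A = (U ** T A ** V) $ 1 $ 1" for A
  define g where "g A = (U ** T A ** V) $ 2 $ 2" for A
  have lin: "f (A + B) = f A + f B" "g (A + B) = g A + g B"
    "f (c *\<^sub>M A) = c * f A" "g (c *\<^sub>M A) = c * g A" for A B c
    by (simp_all add: f_def g_def clinear_add[OF T] clinear_scale[OF T] matrix_add_ldistrib
        matrix_add_rdistrib cscale_mult_left cscale_mult_right) (simp_all add: cscale_def)
  have fX0: "f X0 = a" "g X0 = b" by (simp_all add: f_def g_def UV)
  have parT: "parallel (U ** T A ** V) (U ** T B ** V)" if "parallel A B" for A B
    using par that parallel_unitary[OF unit_quats_unitary[OF UV(1)] unit_quats_unitary[OF UV(2)]]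
    by (simp add: preserves_parallel_def)
  have "parallel X0 Y" if "Y \<in> quats" for Y
    using pencil_parallel[OF X0(1) that, of 1 0 0 1] by (simp add: cscale_1 cscale_0)
  then have dq: "U ** T Y ** V = mat2 (f Y) 0 0 (g Y)" and gf: "cmod (g Y) \<le> cmod (f Y)"
    if "Y \<in> quats" for Y
    using parT[of X0 Y, unfolded UV(3)] that ba unfolding f_def g_def
    by (metis parallel_diagD mat2_nth)+
  have dA: "U ** T A ** V = mat2 (f A) 0 0 (g A)" for A
  proof -
    obtain X Y where XY: "X \<in> quats" "Y \<in> quats" "A = X + \<i> *\<^sub>M Y" by (rule quat_parts)
    have "U ** T A ** V = U ** T X ** V + \<i> *\<^sub>M (U ** T Y ** V)"
      by (simp add: XY(3) clinear_add[OF T] clinear_scale[OF T] matrix_add_ldistrib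
        matrix_add_rdistrib cscale_mult_left cscale_mult_right)
    also have "\<dots> = mat2 (f A) 0 0 (g A)"
      by (simp add: dq XY lin)
    finally show ?thesis .
  qed
  show ?thesis
  proof (cases "\<forall>A. f A = 0 \<longrightarrow> g A = 0")
    case True
    have g: "g A = f A * (b / a)" for A
    proof -
      have "f (A + (- (f A / a)) *\<^sub>M X0) = 0" unfolding lin fX0 using a0 by simp
      then have "g (A + (- (f A / a)) *\<^sub>M X0) = 0" using True by blast
      then show ?thesis unfolding lin fX0 by simp
    qed
    have "T A = f A *\<^sub>M (adjoint_matrix U ** mat2 1 0 0 (b / a) ** adjoint_matrix V)" for A
    proof -
      have "T A = adjoint_matrix U ** (U ** T A ** V) ** adjoint_matrix V"
        by (rule unitary_undo[symmetric, OF unit_quats_unitary[OF UV(1)] unit_quats_unitary[OF UV(2)]])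
      also have "U ** T A ** V = f A *\<^sub>M mat2 1 0 0 (b / a)" by (simp add: dA g)
      finally show ?thesis by (simp only: cscale_mult_left cscale_mult_right)
    qed
    then show ?thesis by blast
  next
    case False
    then obtain Z where Z: "f Z = 0" "g Z \<noteq> 0" by blast
    obtain X Y where XY: "X \<in> quats" "Y \<in> quats" "Z = X + \<i> *\<^sub>M Y" by (rule quat_parts)
    have fg: "cmod (f N) = cmod (g N)"
      if N: "N = of_real r *\<^sub>M X + of_real s *\<^sub>M Y" for N r s
    proof (rule antisym)
      have "parallel (\<i> *\<^sub>M Y + 1 *\<^sub>M X) (of_real s *\<^sub>M Y + of_real r *\<^sub>M X)"
        by (intro pencil_parallel XY) simp_all
      then have "parallel Z N" by (simp add: N XY(3) add.commute cscale_1)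
      from parT[OF this] have "parallel (mat2 0 0 0 (g Z)) (mat2 (f N) 0 0 (g N))"
        by (simp add: dA Z(1))
      then have "parallel (mat2 (g Z) 0 0 0) (mat2 (g N) 0 0 (f N))"
        by (simp only: parallel_diag_flip)
      then show "cmod (f N) \<le> cmod (g N)"
        by (rule parallel_diagD) (use Z(2) in auto)
      have "N \<in> quats" unfolding N by (intro quats_add quats_scaleR XY)
      then show "cmod (g N) \<le> cmod (f N)" by (rule gf)
    qed
    have fY: "f Y = \<i> * f X"
    proof -
      have "f X + \<i> * f Y = 0" using Z(1) by (simp add: XY(3) lin)
      then have "\<i> * (f X + \<i> * f Y) = 0" by simp
      then show ?thesis by (simp add: algebra_simps)
    qed
    have fX: "f X \<noteq> 0"
    proof
      assume "f X = 0"
      moreover have "f Y = 0" using fY calculation by simp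
      ultimately have "g X = 0" "g Y = 0"
        using fg[of X 1 0] fg[of Y 0 1] by (simp_all add: cscale_1 cscale_0)
      then show False using Z(2) by (simp add: XY(3) lin)
    qed
    \<comment> \<open>As f Y = i f X, the values of f at real combinations of X and Y fill the complex plane;
      N is the combination with f N = i f X0.\<close>
    define w where "w = \<i> * f X0 / f X"
    define N where "N = of_real (Re w) *\<^sub>M X + of_real (Im w) *\<^sub>M Y"
    have "f N = w * f X"
      unfolding N_def lin fY by (subst (3) complex_eq[of w]) (simp add: algebra_simps)
    then have fN: "f N = \<i> * f X0" using fX by (simp add: w_def)
    have Nq: "N \<in> quats" unfolding N_def by (intro quats_add quats_scaleR XY)
    define K where "K = X0 + \<i> *\<^sub>M N"
    have fK: "f K = 0" unfolding K_def lin fN by simp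
    show ?thesis
    proof (cases "g K = 0")
      case True
      then have "g X0 = - \<i> * g N" unfolding K_def lin by (simp add: eq_neg_iff_add_eq_0)
      then have "cmod (g X0) = cmod (f N)" using fg[OF N_def] by (simp add: norm_mult)
      then show ?thesis using ba by (simp add: fN fX0 norm_mult)
    next
      case False
      have "parallel (\<i> *\<^sub>M N + 1 *\<^sub>M X0) (0 *\<^sub>M N + 1 *\<^sub>M X0)"
        by (intro pencil_parallel Nq X0) simp_all
      then have "parallel K X0" by (simp add: K_def add.commute cscale_1 cscale_0)
      from parT[OF this] have "parallel (mat2 0 0 0 (g K)) (mat2 a 0 0 b)"
        by (simp add: dA fK fX0)
      then have "parallel (mat2 (g K) 0 0 0) (mat2 b 0 0 a)"
        by (simp only: parallel_diag_flip)
      then have "cmod a \<le> cmod b"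
        by (rule parallel_diagD) (use False in auto)
      then show ?thesis using ba by simp
    qed
  qed
qed

text \<open>Splitting \<open>P + \<mu> Q = z S\<close> into quaternion parts gives two real equations; if \<open>\<mu>\<close> is not real and \<open>Q \<noteq> 0\<close>, the
  second one makes \<open>S\<close> a multiple of \<open>Q\<close>, and then the first makes \<open>P\<close> a multiple of \<open>Q\<close>.\<close>

lemma quat_sum_in_phase_quats:
  assumes PQ: "P \<in> quats" "Q \<in> quats" and ind: "\<And>c. P \<noteq> c *\<^sub>M Q"
    and ph: "P + \<mu> *\<^sub>M Q \<in> phase_quats"
  shows "\<mu> *\<^sub>M Q \<in> quats"
proof -
  obtain z S where S: "S \<in> quats" "P + \<mu> *\<^sub>M Q = z *\<^sub>M S" using ph by (auto simp: phase_quats_def)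
  have split: "w *\<^sub>M M = of_real (Re w) *\<^sub>M M + \<i> *\<^sub>M (of_real (Im w) *\<^sub>M M)" for w M
    by (subst complex_eq[of w]) (simp add: cscale_distrib cscale_assoc)
  have "(P + of_real (Re \<mu>) *\<^sub>M Q) + \<i> *\<^sub>M (of_real (Im \<mu>) *\<^sub>M Q)
    = of_real (Re z) *\<^sub>M S + \<i> *\<^sub>M (of_real (Im z) *\<^sub>M S)"
    using S(2) split[of \<mu> Q] split[of z S] by (simp add: add.assoc)
  then have 1: "P + of_real (Re \<mu>) *\<^sub>M Q = of_real (Re z) *\<^sub>M S"
    and 2: "of_real (Im \<mu>) *\<^sub>M Q = of_real (Im z) *\<^sub>M S"
    by (rule quat_parts_unique[rotated 4]; intro quats_add quats_scaleR PQ S)+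
  show ?thesis
  proof (cases "Im \<mu> = 0")
    case True
    then have "\<mu> = of_real (Re \<mu>)" by (simp add: complex_eq_iff)
    then show ?thesis using quats_scaleR[OF PQ(2)] by metis
  next
    case False
    show ?thesis
    proof (cases "Im z = 0")
      case True
      then have "Q = 0" using 2 False by simp
      then show ?thesis using PQ by (simp add: cscale_zero)
    next
      case Fz: False
      have "S = (1 / of_real (Im z)) *\<^sub>M (of_real (Im z) *\<^sub>M S)"
        using Fz by (simp add: cscale_assoc cscale_1)
      then have "S = (of_real (Im \<mu>) / of_real (Im z)) *\<^sub>M Q"
        by (simp add: 2[symmetric] cscale_assoc)
      then have "P + of_real (Re \<mu>) *\<^sub>M Q = (of_real (Re z) * of_real (Im \<mu>) / of_real (Im z)) *\<^sub>M Q"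
        using 1 by (simp add: cscale_assoc)
      then have "P = (of_real (Re z) * of_real (Im \<mu>) / of_real (Im z) - of_real (Re \<mu>)) *\<^sub>M Q"
        by (metis add_diff_cancel_right' cmat.scale_left_diff_distrib)
      then show ?thesis using ind by blast
    qed
  qed
qed

text \<open>Normalize the phase so that one nonzero image \<open>S X1\<close> is a quaternion. Applying
  \<open>quat_sum_in_phase_quats\<close> to the image of \<open>X1 + X\<close> shows that every image independent of it
  is a quaternion; an image dependent on it is compared with an independent one in the same way.\<close>

lemma parallel_preserver_cases:
  assumes T: "clinear T" and par: "preserves_parallel T"
  shows "(\<exists>Z. \<forall>A. \<exists>c. T A = c *\<^sub>M Z) \<or>
    (\<exists>l. cmod l = 1 \<and> (\<forall>X\<in>quats. l *\<^sub>M T X \<in> quats))"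
proof (intro disj_imp[THEN iffD2] impI)
  assume rank: "\<nexists>Z. \<forall>A. \<exists>c. T A = c *\<^sub>M Z"
  have ph: "T X \<in> phase_quats" if "X \<in> quats" for X
    using rank_one_or_phase_image[OF T par that] rank by blast
  have escape: "\<exists>X\<in>quats. \<forall>c. T X \<noteq> c *\<^sub>M Z" for Z
  proof (rule ccontr)
    assume "\<not> ?thesis"
    then have *: "\<exists>c. T X = c *\<^sub>M Z" if "X \<in> quats" for X using that by blast
    have "\<exists>c. T A = c *\<^sub>M Z" for A
    proof -
      obtain X Y where XY: "X \<in> quats" "Y \<in> quats" "A = X + \<i> *\<^sub>M Y" by (rule quat_parts)
      obtain c d where "T X = c *\<^sub>M Z" "T Y = d *\<^sub>M Z" using * XY by metis
      then have "T A = (c + \<i> * d) *\<^sub>M Z"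
        by (simp add: XY(3) clinear_add[OF T] clinear_scale[OF T] cscale_assoc cscale_distrib)
      then show ?thesis by blast
    qed
    with rank show False by blast
  qed
  obtain X1 where X1: "X1 \<in> quats" "T X1 \<noteq> 0"
    using escape[of 0] by (metis cscale_zero)
  obtain z P where P: "P \<in> quats" "T X1 = z *\<^sub>M P" using ph[OF X1(1)] by (auto simp: phase_quats_def)
  have z0: "z \<noteq> 0" using P X1 by (auto simp: cscale_0)
  define l where "l = cnj z / cmod z"
  have l1: "cmod l = 1" using z0 by (simp add: l_def norm_divide)
  then have l0: "l \<noteq> 0" by auto
  define S where "S X = l *\<^sub>M T X" for X
  have S_add: "S (X + Y) = S X + S Y" for X Y by (simp add: S_def clinear_add[OF T] cmat.scale_right_distrib)
  have S_ph: "S X \<in> phase_quats" if "X \<in> quats" for X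
    using ph[OF that] by (fastforce simp: S_def phase_quats_def cscale_assoc)
  have S_escape: "\<exists>X\<in>quats. \<forall>c. S X \<noteq> c *\<^sub>M Z" for Z
  proof -
    obtain X where X: "X \<in> quats" "\<And>c. T X \<noteq> c *\<^sub>M Z" using escape[of Z] by blast
    have "S X \<noteq> c *\<^sub>M Z" for c
    proof
      assume "S X = c *\<^sub>M Z"
      then have "inverse l *\<^sub>M (l *\<^sub>M T X) = (inverse l * c) *\<^sub>M Z" by (simp add: S_def cscale_assoc)
      then have "T X = (inverse l * c) *\<^sub>M Z" using l0 by (simp add: cscale_assoc cscale_1)
      then show False using X(2) by blast
    qed
    then show ?thesis using X(1) by blast
  qed
  have "cnj z / cmod z * z = cmod z"
    using z0 complex_norm_square[of z] by (simp add: field_simps power2_eq_square)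
  then have "S X1 = of_real (cmod z) *\<^sub>M P" by (simp add: S_def P(2) l_def cscale_assoc)
  then have SX1: "S X1 \<in> quats" using quats_scaleR[OF P(1)] by simp
  have SX10: "S X1 \<noteq> 0" using X1(2) l0 by (simp add: S_def)
  have indep: "S X \<in> quats" if X: "X \<in> quats" "\<And>c. S X \<noteq> c *\<^sub>M S X1" for X
  proof -
    obtain m Q where Q: "Q \<in> quats" "S X = m *\<^sub>M Q" using S_ph[OF X(1)] by (auto simp: phase_quats_def)
    have "S X1 \<noteq> c *\<^sub>M Q" for c
    proof
      assume c: "S X1 = c *\<^sub>M Q"
      then have "c \<noteq> 0" using SX10 by (auto simp: cscale_0)
      then have "S X = (m / c) *\<^sub>M S X1" by (simp add: c Q(2) cscale_assoc)
      then show False using X(2) by blast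
    qed
    moreover have "S X1 + m *\<^sub>M Q \<in> phase_quats"
      using S_ph[OF quats_add[OF X1(1) X(1)]] by (simp add: S_add Q(2))
    ultimately show ?thesis using quat_sum_in_phase_quats[OF SX1 Q(1)] Q(2) by simp
  qed
  obtain X2 where X2: "X2 \<in> quats" "\<And>c. S X2 \<noteq> c *\<^sub>M S X1" using S_escape[of "S X1"] by blast
  have "S X \<in> quats" if X: "X \<in> quats" for X
  proof (cases "\<exists>c. S X = c *\<^sub>M S X1")
    case True
    then obtain c where c: "S X = c *\<^sub>M S X1" by blast
    have "S X2 + c *\<^sub>M S X1 \<in> phase_quats"
      using S_ph[OF quats_add[OF X2(1) X]] by (simp add: S_add c)
    then show ?thesis
      using quat_sum_in_phase_quats[OF indep[OF X2] SX1 X2(2)] c by simp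
  qed (use indep X in blast)
  then show "\<exists>l. cmod l = 1 \<and> (\<forall>X\<in>quats. l *\<^sub>M T X \<in> quats)"
    using l1 by (auto simp: S_def)
qed


section \<open>A singular value decomposition for quaternionic maps\<close>

text \<open>The orthogonal basis \<open>I\<close>, \<open>\<i> C\<^sub>1\<close>, \<open>\<i> C\<^sub>2\<close>, \<open>\<i> C\<^sub>3\<close> of the quaternions, where the \<open>C\<^sub>j\<close> are the Pauli matrices; its
  elements have real squared length \<open>2\<close>.\<close>

definition quat_unit :: "nat \<Rightarrow> complex^2^2" where
  "quat_unit i = (if i = 0 then quat 1 0 else if i = 1 then quat \<i> 0
     else if i = 2 then quat 0 \<i> else quat 0 1)"

lemma less4_cases: "i < 4 \<Longrightarrow> i = 0 \<or> i = 1 \<or> i = 2 \<or> i = (3::nat)"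
  by linarith

lemma quat_unit_in_quats: "quat_unit i \<in> quats"
  by (simp add: quat_unit_def)

lemma mat2_scaleR [simp]: "r *\<^sub>R mat2 a b c d = mat2 (of_real r * a) (of_real r * b) (of_real r * c) (of_real r * d)"
  by (simp flip: cscale_of_real)

lemma mat2_inner: "mat2 a b c d \<bullet> mat2 a' b' c' d' = a \<bullet> a' + b \<bullet> b' + c \<bullet> c' + d \<bullet> d'"
  by (simp add: inner_vec_def sum_2)

lemma quat_expand:
  assumes "X \<in> quats"
  shows "X = (\<Sum>i<4. ((X \<bullet> quat_unit i) / 2) *\<^sub>R quat_unit i)"
proof -
  obtain p q where X: "X = quat p q" using assms by (rule quatsE)
  have "{..<4} = {0, 1, 2, 3 :: nat}" by auto
  then show ?thesis
    by (simp add: X quat_unit_def quat_def mat2_inner inner_complex_def complex_eq_iff)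
qed

lemma inner_unitary:
  assumes "U \<in> unit_quats" "V \<in> unit_quats"
  shows "(U ** X ** V) \<bullet> Y = X \<bullet> (adjoint_matrix U ** Y ** adjoint_matrix V)"
proof -
  obtain u1 u2 v1 v2 where U: "U = quat u1 u2" and V: "V = quat v1 v2"
    using assms by (auto simp: unit_quats_def)
  obtain a b c d where X: "X = mat2 a b c d" by (rule mat2_cases)
  obtain e f g h where Y: "Y = mat2 e f g h" by (rule mat2_cases)
  have *: "z \<bullet> w = Re (z * cnj w)" for z w by (simp add: inner_complex_def)
  show ?thesis
    unfolding U V X Y quat_def mat2_mult mat2_adjoint mat2_inner * plus_complex.sel(1)[symmetric]
    by (rule arg_cong[where f = Re]) (simp add: algebra_simps)
qed

text \<open>For a unit quaternion \<open>E = cos (t/2) + sin (t/2) k\<close> with an imaginary unit \<open>k\<close>, the map \<open>X \<mapsto> E X E\<close>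
  rotates the plane of \<open>1\<close> and \<open>k\<close> by the angle \<open>t\<close> and fixes its orthogonal complement, and
  \<open>X \<mapsto> E X E\<^sup>*\<close> rotates the plane of the other two imaginary units and fixes \<open>1\<close> and \<open>k\<close>. This covers
  all six coordinate planes.\<close>

lemma plane_rotation:
  assumes ij: "i < j" "j < 4" and ab: "a\<^sup>2 + b\<^sup>2 = 1"
  obtains U V where "U \<in> unit_quats" "V \<in> unit_quats"
    "U ** quat_unit i ** V = a *\<^sub>R quat_unit i + b *\<^sub>R quat_unit j"
    "U ** quat_unit j ** V = a *\<^sub>R quat_unit j - b *\<^sub>R quat_unit i"
    "\<And>l. l < 4 \<Longrightarrow> l \<noteq> i \<Longrightarrow> l \<noteq> j \<Longrightarrow> U ** quat_unit l ** V = quat_unit l"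
proof -
  obtain t where t: "a = cos t" "b = sin t" using ab by (metis sincos_total_2pi)
  define c s where "c = cos (t / 2)" and "s = sin (t / 2)"
  have cs: "c * c + s * s = 1" by (simp add: c_def s_def flip: power2_eq_square)
  have a: "a = c * c - s * s" using cos_double[of "t / 2"] by (simp add: t c_def s_def power2_eq_square)
  have b: "b = 2 * s * c" using sin_double[of "t / 2"] by (simp add: t c_def s_def)
  \<comment> \<open>The matrix of c + s (x k1 + y k2 + z k3) for the imaginary units k1, k2, k3. They multiply by
    k1 k2 = - k3 and its cyclic shifts, whence the signs in the last three cases.\<close>
  define E where "E x y z = quat (Complex c (s * x)) (Complex (s * z) (s * y))" for x y z
  define rot where "rot U V \<longleftrightarrow> U \<in> unit_quats \<and> V \<in> unit_quats \<and>
    U ** quat_unit i ** V = a *\<^sub>R quat_unit i + b *\<^sub>R quat_unit j \<and>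
    U ** quat_unit j ** V = a *\<^sub>R quat_unit j - b *\<^sub>R quat_unit i \<and>
    (\<forall>l<4. l \<noteq> i \<longrightarrow> l \<noteq> j \<longrightarrow> U ** quat_unit l ** V = quat_unit l)" for U V
  have all4: "(\<forall>l<4. P l) \<longleftrightarrow> P 0 \<and> P 1 \<and> P 2 \<and> P (3::nat)" for P
    using less4_cases by auto
  have cs': "c * (c * z) + s * (s * z) = z" "s * (s * z) + c * (c * z) = z" for z
    using cs by (metis distrib_right mult.assoc mult_1 add.commute)+
  have minus: "X - Y = X + (-1) *\<^sub>R Y" for X Y :: "complex^2^2" by simp
  consider "i = 0" "j = 1" | "i = 0" "j = 2" | "i = 0" "j = 3" | "i = 1" "j = 2"
    | "i = 1" "j = 3" | "i = 2" "j = 3"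
    using ij by linarith
  then have "\<exists>U V. rot U V"
  proof cases
    case 1
    then have "rot (E 1 0 0) (E 1 0 0)"
      using cs cs' unfolding rot_def minus
      by (simp add: E_def quat_unit_def all4 a b quat_in_unit_quats; simp add: quat_def complex_eq_iff algebra_simps)
    then show ?thesis by blast
  next
    case 2
    then have "rot (E 0 1 0) (E 0 1 0)"
      using cs cs' unfolding rot_def minus
      by (simp add: E_def quat_unit_def all4 a b quat_in_unit_quats; simp add: quat_def complex_eq_iff algebra_simps)
    then show ?thesis by blast
  next
    case 3
    then have "rot (E 0 0 1) (E 0 0 1)"
      using cs cs' unfolding rot_def minus
      by (simp add: E_def quat_unit_def all4 a b quat_in_unit_quats; simp add: quat_def complex_eq_iff algebra_simps)
    then show ?thesis by blast
  next
    case 4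
    then have "rot (E 0 0 (-1)) (E 0 0 1)"
      using cs cs' unfolding rot_def minus
      by (simp add: E_def quat_unit_def all4 a b quat_in_unit_quats; simp add: quat_def complex_eq_iff algebra_simps)
    then show ?thesis by blast
  next
    case 5
    then have "rot (E 0 1 0) (E 0 (-1) 0)"
      using cs cs' unfolding rot_def minus
      by (simp add: E_def quat_unit_def all4 a b quat_in_unit_quats; simp add: quat_def complex_eq_iff algebra_simps)
    then show ?thesis by blast
  next
    case 6
    then have "rot (E (-1) 0 0) (E 1 0 0)"
      using cs cs' unfolding rot_def minus
      by (simp add: E_def quat_unit_def all4 a b quat_in_unit_quats; simp add: quat_def complex_eq_iff algebra_simps)
    then show ?thesis by blast
  qed
  then show ?thesis using that by (auto simp: rot_def)
qed

lemma compact_unit_quats: "compact unit_quats"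
proof -
  let ?S = "{U :: complex^2^2. U$1$1 * cnj (U$1$1) + U$1$2 * cnj (U$1$2) = 1 \<and>
     U$2$1 = - cnj (U$1$2) \<and> U$2$2 = cnj (U$1$1)}"
  have eq: "unit_quats = ?S"
  proof (intro equalityI subsetI)
    fix U :: "complex^2^2" assume U: "U \<in> ?S"
    then have "U = quat (U$1$1) (U$1$2)" using mat2_eta[of U] by (simp add: quat_def)
    with U show "U \<in> unit_quats" unfolding unit_quats_def by blast
  qed (auto simp: unit_quats_def quat_def)
  have "closed ?S"
    by (intro closed_Collect_conj closed_Collect_eq continuous_intros)
  moreover have "norm U = sqrt 2" if unit: "U \<in> unit_quats" for U
  proof -
    obtain p q where U: "U = quat p q" and 1: "p * cnj p + q * cnj q = 1"
      using unit unfolding unit_quats_def by blast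
    have "U \<bullet> U = 2 * Re (p * cnj p + q * cnj q)"
      by (simp add: U quat_def mat2_inner inner_complex_def)
    then show ?thesis by (simp add: norm_eq_sqrt_inner 1)
  qed
  then have "bounded unit_quats" unfolding bounded_iff by (metis order_refl)
  ultimately show ?thesis by (simp add: compact_eq_bounded_closed eq)
qed

lemma continuous_on_matrix_mult [continuous_intros]:
  fixes f g :: "'a::topological_space \<Rightarrow> complex^2^2"
  assumes "continuous_on S f" "continuous_on S g"
  shows "continuous_on S (\<lambda>x. f x ** g x)"
  unfolding matrix_matrix_mult_def
  by (intro continuous_on_vec_lambda continuous_intros assms)

lemma clinear_scaleR: "clinear T \<Longrightarrow> T (r *\<^sub>R A) = r *\<^sub>R T A"
  by (simp add: clinear_scale flip: cscale_of_real)

lemma clinear_continuous: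
  assumes "clinear T" "continuous_on S f"
  shows "continuous_on S (\<lambda>x. T (f x))"
proof -
  have "linear T" by (rule linearI) (simp_all add: clinear_add clinear_scaleR assms(1))
  then have "continuous_on UNIV T" by (rule linear_continuous_on[OF linear_conv_bounded_linear[THEN iffD1]])
  then show ?thesis using assms(2) by (rule continuous_on_compose2) auto
qed

text \<open>A sinusoid \<open>\<alpha> cos t + \<beta> sin t\<close> that is maximal at \<open>t = 0\<close> has \<open>\<beta> = 0\<close>: its maximum is
  \<open>sqrt (\<alpha>\<^sup>2 + \<beta>\<^sup>2)\<close>.\<close>

lemma circle_maximum:
  fixes \<alpha> \<beta> :: real
  assumes "\<And>a b. a\<^sup>2 + b\<^sup>2 = 1 \<Longrightarrow> a * \<alpha> + b * \<beta> \<le> \<alpha>"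
  shows "\<beta> = 0"
proof (cases "\<alpha>\<^sup>2 + \<beta>\<^sup>2 = 0")
  case True
  then show ?thesis by (simp add: sum_power2_eq_zero_iff)
next
  case False
  define r where "r = sqrt (\<alpha>\<^sup>2 + \<beta>\<^sup>2)"
  have r: "r\<^sup>2 = \<alpha>\<^sup>2 + \<beta>\<^sup>2" "r \<ge> 0" by (simp_all add: r_def)
  have r0: "r \<noteq> 0" using False r by auto
  have "(\<alpha> / r)\<^sup>2 + (\<beta> / r)\<^sup>2 = 1"
    using False r0 r(1) by (simp add: power_divide flip: add_divide_distrib)
  then have "\<alpha> / r * \<alpha> + \<beta> / r * \<beta> \<le> \<alpha>" by (rule assms)
  also have "\<alpha> / r * \<alpha> + \<beta> / r * \<beta> = r\<^sup>2 / r" unfolding r(1) by (simp add: power2_eq_square add_divide_distrib)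
  also have "\<dots> = r" using r0 by (simp add: power2_eq_square)
  finally have "r\<^sup>2 \<le> \<alpha>\<^sup>2" using r(2) by (intro power_mono)
  then show ?thesis using r(1) by simp
qed

text \<open>Maximize the weighted trace \<open>\<Sum> l m\<^sub>l\<^sub>l\<close>, with the distinct weights \<open>0, 1, 2, 3\<close>, of the matrix \<open>m\<close> of
  \<open>X \<mapsto> U1 R(U2 X V2) V1\<close> over the compact set of all quadruples of unit quaternions. Composing with a rotation in the
  plane of the \<open>i\<close>-th and \<open>j\<close>-th basis quaternions, once on the right and once on the left, gives
  \<open>i m\<^sub>i\<^sub>j = j m\<^sub>j\<^sub>i\<close> and \<open>i m\<^sub>j\<^sub>i = j m\<^sub>i\<^sub>j\<close> at a maximum. Since the squares of the weights are distinct,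
  the off-diagonal entries vanish.\<close>

lemma quaternionic_svd:
  assumes R: "clinear R" and Rq: "\<And>X. X \<in> quats \<Longrightarrow> R X \<in> quats"
  obtains U1 V1 U2 V2 d where "U1 \<in> unit_quats" "V1 \<in> unit_quats" "U2 \<in> unit_quats" "V2 \<in> unit_quats"
    "\<And>i. i < 4 \<Longrightarrow> U1 ** R (U2 ** quat_unit i ** V2) ** V1 = d i *\<^sub>R quat_unit i"
proof -
  define \<Phi> where "\<Phi> = (\<lambda>(U1, V1, U2, V2).
    \<Sum>l<4. real l * ((U1 ** R (U2 ** quat_unit l ** V2) ** V1) \<bullet> quat_unit l))"
  let ?K = "unit_quats \<times> unit_quats \<times> unit_quats \<times> unit_quats"
  have "compact ?K" by (intro compact_Times compact_unit_quats)
  moreover have "?K \<noteq> {}" using unit_quats_one by blast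
  moreover have "continuous_on ?K \<Phi>"
    unfolding \<Phi>_def case_prod_unfold
    by (intro continuous_intros clinear_continuous[OF R])
  ultimately have "\<exists>x\<in>?K. \<forall>y\<in>?K. \<Phi> y \<le> \<Phi> x"
    by (rule continuous_attains_sup)
  then obtain x where "x \<in> ?K" and xmax: "\<And>y. y \<in> ?K \<Longrightarrow> \<Phi> y \<le> \<Phi> x"
    by (elim bexE) (rule that, assumption, erule (1) bspec)
  then obtain U1 V1 U2 V2 where x: "x = (U1, V1, U2, V2)"
    and U: "U1 \<in> unit_quats" "V1 \<in> unit_quats" "U2 \<in> unit_quats" "V2 \<in> unit_quats" by auto
  define M where "M X = U1 ** R (U2 ** X ** V2) ** V1" for X
  have M: "clinear M" unfolding M_def by (rule clinear_unitary[OF R])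
  have Mq: "M X \<in> quats" if "X \<in> quats" for X
    unfolding M_def by (intro quats_mult Rq unit_quats_subset U that)
  define m where "m p q = M (quat_unit q) \<bullet> quat_unit p" for p q
  have \<Phi>x: "\<Phi> x = (\<Sum>l<4. real l * m l l)" by (simp add: \<Phi>_def x M_def m_def)
  have right: "(\<Sum>l<4. real l * (M (U ** quat_unit l ** V) \<bullet> quat_unit l)) \<le> (\<Sum>l<4. real l * m l l)"
    if "U \<in> unit_quats" "V \<in> unit_quats" for U V
    using xmax[of "(U1, V1, U2 ** U, V ** V2)"] U that unit_quats_mult
    unfolding \<Phi>x by (simp add: \<Phi>_def M_def matrix_mul_assoc)
  have left: "(\<Sum>l<4. real l * (M (quat_unit l) \<bullet> (U ** quat_unit l ** V))) \<le> (\<Sum>l<4. real l * m l l)"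
    if UV: "U \<in> unit_quats" "V \<in> unit_quats" for U V
  proof -
    have "M (quat_unit l) \<bullet> (U ** quat_unit l ** V)
      = ((adjoint_matrix U ** U1) ** R (U2 ** quat_unit l ** V2) ** (V1 ** adjoint_matrix V)) \<bullet> quat_unit l" for l
      unfolding inner_commute[of "M _"] inner_unitary[OF UV]
      by (simp add: inner_commute M_def matrix_mul_assoc)
    then show ?thesis
      using xmax[of "(adjoint_matrix U ** U1, V1 ** adjoint_matrix V, U2, V2)"] U UV
        unit_quats_mult unit_quats_adjoint
      unfolding \<Phi>x by (simp add: \<Phi>_def)
  qed
  have vary: "real i * (g i - m i i) + real j * (g j - m j j) \<le> 0"
    if ij: "i < j" "j < 4" and le: "(\<Sum>l<4. real l * g l) \<le> (\<Sum>l<4. real l * m l l)"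
      and g: "\<And>l. l < 4 \<Longrightarrow> l \<noteq> i \<Longrightarrow> l \<noteq> j \<Longrightarrow> g l = m l l" for i j :: nat and g
  proof -
    have "real i * (g i - m i i) + real j * (g j - m j j) = (\<Sum>l\<in>{i, j}. real l * (g l - m l l))"
      using ij by simp
    also have "\<dots> = (\<Sum>l<4. real l * (g l - m l l))"
      using ij g by (intro sum.mono_neutral_left) auto
    also have "\<dots> \<le> 0" using le by (simp add: right_diff_distrib sum_subtractf)
    finally show ?thesis .
  qed
  have off: "m i j = 0 \<and> m j i = 0" if ij: "i < j" "j < 4" for i j
  proof -
    have "real i * m i j - real j * m j i = 0"
    proof (rule circle_maximum[of "real i * m i i + real j * m j j"])
      fix a b :: real assume "a\<^sup>2 + b\<^sup>2 = 1"
      then obtain U V where UV: "U \<in> unit_quats" "V \<in> unit_quats"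
        "U ** quat_unit i ** V = a *\<^sub>R quat_unit i + b *\<^sub>R quat_unit j"
        "U ** quat_unit j ** V = a *\<^sub>R quat_unit j - b *\<^sub>R quat_unit i"
        "\<And>l. l < 4 \<Longrightarrow> l \<noteq> i \<Longrightarrow> l \<noteq> j \<Longrightarrow> U ** quat_unit l ** V = quat_unit l"
        using plane_rotation[OF ij] by metis
      have minus: "X - c *\<^sub>R Y = X + (- c) *\<^sub>R Y" for X Y :: "complex^2^2" and c by simp
      have Mi: "M (U ** quat_unit i ** V) \<bullet> quat_unit i = a * m i i + b * m i j"
        by (simp add: UV(3) clinear_add[OF M] clinear_scaleR[OF M] m_def inner_add_left)
      have Mj: "M (U ** quat_unit j ** V) \<bullet> quat_unit j = a * m j j - b * m j i"
        unfolding UV(4) minus by (simp only: clinear_add[OF M] clinear_scaleR[OF M])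
          (simp add: m_def inner_diff_left)
      have "real i * (M (U ** quat_unit i ** V) \<bullet> quat_unit i - m i i)
        + real j * (M (U ** quat_unit j ** V) \<bullet> quat_unit j - m j j) \<le> 0"
        by (rule vary[OF ij right[OF UV(1,2)]]) (simp add: UV(5) m_def)
      then show "a * (real i * m i i + real j * m j j) + b * (real i * m i j - real j * m j i)
        \<le> real i * m i i + real j * m j j"
        unfolding Mi Mj by (simp add: algebra_simps)
    qed
    moreover have "real i * m j i - real j * m i j = 0"
    proof (rule circle_maximum[of "real i * m i i + real j * m j j"])
      fix a b :: real assume "a\<^sup>2 + b\<^sup>2 = 1"
      then obtain U V where UV: "U \<in> unit_quats" "V \<in> unit_quats"
        "U ** quat_unit i ** V = a *\<^sub>R quat_unit i + b *\<^sub>R quat_unit j"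
        "U ** quat_unit j ** V = a *\<^sub>R quat_unit j - b *\<^sub>R quat_unit i"
        "\<And>l. l < 4 \<Longrightarrow> l \<noteq> i \<Longrightarrow> l \<noteq> j \<Longrightarrow> U ** quat_unit l ** V = quat_unit l"
        using plane_rotation[OF ij] by metis
      have Mi: "M (quat_unit i) \<bullet> (U ** quat_unit i ** V) = a * m i i + b * m j i"
        by (simp add: UV(3) m_def inner_add_right)
      have Mj: "M (quat_unit j) \<bullet> (U ** quat_unit j ** V) = a * m j j - b * m i j"
        by (simp add: UV(4) m_def inner_diff_right)
      have "real i * (M (quat_unit i) \<bullet> (U ** quat_unit i ** V) - m i i)
        + real j * (M (quat_unit j) \<bullet> (U ** quat_unit j ** V) - m j j) \<le> 0"
        by (rule vary[OF ij left[OF UV(1,2)]]) (simp add: UV(5) m_def)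
      then show "a * (real i * m i i + real j * m j j) + b * (real i * m j i - real j * m i j)
        \<le> real i * m i i + real j * m j j"
        unfolding Mi Mj by (simp add: algebra_simps)
    qed
    ultimately have 1: "real i * m i j = real j * m j i" and 2: "real i * m j i = real j * m i j" by simp_all
    have "real i * (real i * m i j) = real j * (real j * m i j)"
      unfolding 1 2[symmetric] by simp
    then have "(real i * real i - real j * real j) * m i j = 0" by (simp add: algebra_simps)
    moreover have "real i * real i < real j * real j" using ij by (intro mult_strict_mono) auto
    ultimately have "m i j = 0" by simp
    then show ?thesis using 1 ij by simp
  qed
  have "M (quat_unit i) = (m i i / 2) *\<^sub>R quat_unit i" if i: "i < 4" for i
  proof -
    have "m l i = 0" if "l < 4" "l \<noteq> i" for l
      using off[of l i] off[of i l] i that by (metis nat_neq_iff)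
    then have "(\<Sum>l<4. (m l i / 2) *\<^sub>R quat_unit l) = (\<Sum>l\<in>{i}. (m l i / 2) *\<^sub>R quat_unit l)"
      using i by (intro sum.mono_neutral_right) auto
    then show ?thesis
      using quat_expand[OF Mq[OF quat_unit_in_quats], of i] by (simp add: m_def)
  qed
  then show ?thesis using that[OF U, of "\<lambda>i. m i i / 2"] by (simp add: M_def)
qed

lemma unitary_phase: "unitary_matrix U \<Longrightarrow> cmod l = 1 \<Longrightarrow> unitary_matrix (l *\<^sub>M (U :: complex^2^2))"
proof -
  assume U: "unitary_matrix U" and "cmod l = 1"
  then have "cnj l * l = 1" using complex_norm_square[of l] by (simp add: mult.commute)
  moreover have "adjoint_matrix (l *\<^sub>M U) = cnj l *\<^sub>M adjoint_matrix U"
    by (simp add: vec_eq_iff adjoint_matrix_def cscale_def)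
  ultimately show ?thesis
    using U by (simp add: unitary_matrix_def cscale_mult_left cscale_mult_right cscale_assoc
        mult.commute[of l])
qed

lemma parallel_preserver_normal_form:
  assumes T: "clinear T" and par: "preserves_parallel T"
  shows "(\<exists>Z. \<forall>A. \<exists>c. T A = c *\<^sub>M Z) \<or>
    (\<exists>U1 V1 U2 V2. \<exists>d :: nat \<Rightarrow> real. unitary_matrix U1 \<and> unitary_matrix V1 \<and>
      unitary_matrix U2 \<and> unitary_matrix V2 \<and>
      (\<forall>i<4. U1 ** T (U2 ** quat_unit i ** V2) ** V1 = d i *\<^sub>R quat_unit i))"
proof (intro disj_imp[THEN iffD2] impI)
  assume "\<nexists>Z. \<forall>A. \<exists>c. T A = c *\<^sub>M Z"
  then obtain l where l: "cmod l = 1" "\<And>X. X \<in> quats \<Longrightarrow> l *\<^sub>M T X \<in> quats"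
    using parallel_preserver_cases[OF T par] by blast
  have R: "clinear (\<lambda>X. l *\<^sub>M T X)"
    by (rule clinearI) (simp_all add: clinear_add[OF T] clinear_scale[OF T]
        cmat.scale_right_distrib cscale_assoc mult.commute)
  obtain U1 V1 U2 V2 d where U: "U1 \<in> unit_quats" "V1 \<in> unit_quats" "U2 \<in> unit_quats" "V2 \<in> unit_quats"
    "\<And>i. i < 4 \<Longrightarrow> U1 ** (l *\<^sub>M T (U2 ** quat_unit i ** V2)) ** V1 = d i *\<^sub>R quat_unit i"
    using quaternionic_svd[OF R l(2)] by blast
  then show "\<exists>U1 V1 U2 V2. \<exists>d :: nat \<Rightarrow> real. unitary_matrix U1 \<and> unitary_matrix V1 \<and>
      unitary_matrix U2 \<and> unitary_matrix V2 \<and>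
      (\<forall>i<4. U1 ** T (U2 ** quat_unit i ** V2) ** V1 = d i *\<^sub>R quat_unit i)"
    by (intro exI[of _ "l *\<^sub>M U1"] exI[of _ V1] exI[of _ U2] exI[of _ V2] exI[of _ d])
      (simp add: unitary_phase l(1) unit_quats_unitary cscale_mult_left cscale_mult_right)
qed


section \<open>Unitary equivalence of maps\<close>

lemma unitary_mult:
  fixes U V :: "complex^2^2"
  assumes "unitary_matrix U" "unitary_matrix V"
  shows "unitary_matrix (U ** V)"
proof -
  have "adjoint_matrix (U ** V) = adjoint_matrix V ** adjoint_matrix U"
    by (simp add: vec_eq_iff adjoint_matrix_def matrix_matrix_mult_def mult.commute)
  then show ?thesis
    using assms unitary_cancel[OF assms(1)] unitary_cancel[OF assms(2)]
    unfolding unitary_matrix_def by (metis matrix_mul_assoc)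
qed

lemma unitary_transpose:
  fixes U :: "complex^2^2"
  assumes "unitary_matrix U"
  shows "unitary_matrix (transpose U)"
proof -
  have "adjoint_matrix (transpose U) = transpose (adjoint_matrix U)"
    by (simp add: vec_eq_iff adjoint_matrix_def transpose_def)
  then show ?thesis
    using assms unfolding unitary_matrix_def by (metis matrix_transpose_mul transpose_mat)
qed

lemma unitary_equivalence_inverse:
  fixes T :: "complex^2^2 \<Rightarrow> complex^2^2"
  assumes "unitary_matrix U1" "unitary_matrix V1" "unitary_matrix U2" "unitary_matrix V2"
  shows "T A = adjoint_matrix U1 ** (U1 ** T (U2 ** (adjoint_matrix U2 ** A ** adjoint_matrix V2) ** V2) ** V1)
    ** adjoint_matrix V1"
  using unitary_cancel[OF assms(1)] unitary_cancel[OF assms(2)]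
    unitary_cancel[OF assms(3)] unitary_cancel[OF assms(4)]
  by (simp add: matrix_mul_assoc)

lemma preserves_parallel_unitary:
  fixes T :: "complex^2^2 \<Rightarrow> complex^2^2"
  assumes U: "unitary_matrix U1" "unitary_matrix V1" "unitary_matrix U2" "unitary_matrix V2"
    and "preserves_parallel (\<lambda>A. U1 ** T (U2 ** A ** V2) ** V1)"
  shows "preserves_parallel T"
  unfolding preserves_parallel_def
proof (intro allI impI)
  fix A B :: "complex^2^2" assume "parallel A B"
  then show "parallel (T A) (T B)"
    using assms(5) unfolding preserves_parallel_def
    by (subst (1 2) unitary_equivalence_inverse[OF U])
      (simp only: parallel_unitary unitary_adjoint U)
qed

lemma preserves_TEA_unitary:
  fixes T :: "complex^2^2 \<Rightarrow> complex^2^2"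
  assumes "unitary_matrix U1" "unitary_matrix V1" "unitary_matrix U2" "unitary_matrix V2"
    and "preserves_TEA T"
  shows "preserves_TEA (\<lambda>A. U1 ** T (U2 ** A ** V2) ** V1)"
  using assms by (simp add: preserves_TEA_def TEA_unitary)

section \<open>Rank one maps\<close>

lemma clinear_entries:
  assumes "clinear T"
  shows "T (mat2 a b c d) = a *\<^sub>M T (mat2 1 0 0 0) + b *\<^sub>M T (mat2 0 1 0 0)
    + c *\<^sub>M T (mat2 0 0 1 0) + d *\<^sub>M T (mat2 0 0 0 1)"
  by (simp flip: clinear_add[OF assms] clinear_scale[OF assms])

text \<open>If \<open>T A = e A *\<^sub>M Z\<close>, then \<open>F\<close> collects the values of \<open>e\<close> at the matrix units, transposed because of
  \<open>trace (F ** A) = \<Sum> F\<^sub>i\<^sub>j A\<^sub>j\<^sub>i\<close>.\<close>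

lemma rank_one_trace_form:
  assumes T: "clinear T" and "\<forall>A. \<exists>c. T A = c *\<^sub>M Z"
  shows "\<exists>F. \<forall>A. T A = trace (F ** A) *\<^sub>M Z"
proof -
  obtain e where e: "\<And>A. T A = e A *\<^sub>M Z" using assms(2) by metis
  let ?F = "mat2 (e (mat2 1 0 0 0)) (e (mat2 0 0 1 0)) (e (mat2 0 1 0 0)) (e (mat2 0 0 0 1))"
  have "T A = trace (?F ** A) *\<^sub>M Z" for A
  proof -
    obtain a b c d where A: "A = mat2 a b c d" by (rule mat2_cases)
    have "T A = a *\<^sub>M T (mat2 1 0 0 0) + b *\<^sub>M T (mat2 0 1 0 0)
      + c *\<^sub>M T (mat2 0 0 1 0) + d *\<^sub>M T (mat2 0 0 0 1)"
      unfolding A by (rule clinear_entries[OF T])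
    also have "\<dots> = trace (?F ** A) *\<^sub>M Z"
      unfolding e A by (simp add: trace_def sum_2 cscale_assoc cscale_distrib algebra_simps)
    finally show ?thesis .
  qed
  then show ?thesis by blast
qed

lemma rank_one_preserves_parallel: "preserves_parallel (\<lambda>A. f A *\<^sub>M Z)"
  unfolding preserves_parallel_def parallel_def
proof (intro allI impI)
  fix A B
  obtain \<mu> where \<mu>: "cmod \<mu> = 1" "cmod (f A + \<mu> * f B) = cmod (f A) + cmod (f B)"
    by (rule phase_exists)
  have "f A *\<^sub>M Z + \<mu> *\<^sub>M f B *\<^sub>M Z = (f A + \<mu> * f B) *\<^sub>M Z"
    by (simp add: cscale_assoc cscale_distrib)
  then show "\<exists>\<mu>. cmod \<mu> = 1 \<and> spectral_norm (f A *\<^sub>M Z + \<mu> *\<^sub>M f B *\<^sub>M Z)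
    = spectral_norm (f A *\<^sub>M Z) + spectral_norm (f B *\<^sub>M Z)"
    using \<mu> by (intro exI[of _ \<mu>]) (simp add: spectral_norm_cscale distrib_right)
qed

section \<open>Coordinates in the Pauli basis\<close>

lemma pauli_sum_representation:
  "(\<Sum>j\<in>UNIV. cmat.representation (range (($) pauli_basis)) A (pauli_basis $ j) *\<^sub>M pauli_basis $ j) = A"
proof -
  let ?B = "range (($) pauli_basis)"
  have "(\<Sum>b\<in>?B. cmat.representation ?B A b *\<^sub>M b) = A"
    by (rule cmat.sum_representation_eq)
      (simp_all add: pauli_basis_independent pauli_basis_span)
  then show ?thesis
    by (simp add: sum.reindex[OF pauli_basis_inj])
qed

lemma pauli_representation:
  "cmat.representation (range (($) pauli_basis)) A (pauli_basis $ i)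
    = trace (adjoint_matrix (pauli_basis $ i) ** A)"
proof -
  let ?r = "\<lambda>j. cmat.representation (range (($) pauli_basis)) A (pauli_basis $ j)"
  let ?t = "\<lambda>A. trace (adjoint_matrix (pauli_basis $ i) ** A)"
  have "?t (X + Y) = ?t X + ?t Y" "?t (c *\<^sub>M X) = c * ?t X" for X Y c
    by (simp_all add: matrix_add_ldistrib cscale_mult_right trace_add)
      (simp add: trace_def cscale_def sum_distrib_left)
  note lin = this
  have "?t A = ?t (\<Sum>j\<in>UNIV. ?r j *\<^sub>M pauli_basis $ j)"
    by (simp only: pauli_sum_representation)
  also have "\<dots> = (\<Sum>j\<in>UNIV. ?r j * ?t (pauli_basis $ j))"
    by (simp only: sum_4 lin)
  also have "\<dots> = ?r i"
    by (simp add: pauli_basis_orthonormal if_distrib cong: if_cong)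
  finally show ?thesis ..
qed

lemma pauli_matrix_of_nth:
  "pauli_matrix_of T $ i $ j = trace (adjoint_matrix (pauli_basis $ i) ** T (pauli_basis $ j))"
  by (simp add: pauli_matrix_of_def pauli_representation)

lemma pauli_matrix_of_column:
  "T (pauli_basis $ j) = (\<Sum>i\<in>UNIV. pauli_matrix_of T $ i $ j *\<^sub>M pauli_basis $ i)"
  by (simp add: pauli_matrix_of_def pauli_sum_representation)

lemma quat_unit_pauli:
  "quat_unit 0 = complex_of_real (sqrt 2) *\<^sub>M pauli_basis $ 1"
  "quat_unit 1 = (\<i> * complex_of_real (sqrt 2)) *\<^sub>M pauli_basis $ 2"
  "quat_unit 2 = (\<i> * complex_of_real (sqrt 2)) *\<^sub>M pauli_basis $ 3"
  "quat_unit 3 = (\<i> * complex_of_real (sqrt 2)) *\<^sub>M pauli_basis $ 4"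
  by (simp_all add: quat_unit_def quat_def pauli_basis_nth cscale_assoc mat2_one
      pauli1_def pauli2_def pauli3_def flip: mat2_def)

lemma vector4_nth [simp]:
  "(vector [a, b, c, d] :: 'a::zero^4) $ 1 = a" "(vector [a, b, c, d] :: 'a::zero^4) $ 2 = b"
  "(vector [a, b, c, d] :: 'a::zero^4) $ 3 = c" "(vector [a, b, c, d] :: 'a::zero^4) $ 4 = d"
  by (simp_all add: vector_def)

text \<open>The basis quaternions are \<open>\<surd>2\<close> times the first and \<open>\<i> \<surd>2\<close> times the other Pauli basis
  elements. In this rescaled basis the entries \<open>\<i> \<gamma>\<^sub>j\<close> of the first row become the real numbers \<open>- \<gamma>\<^sub>j\<close>.\<close>

lemma pauli_form_quaternionic:
  assumes T: "clinear T"
    and M: "pauli_matrix_of T =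
      vector [vector [of_real d0, of_real g1 * \<i>, of_real g2 * \<i>, of_real g3 * \<i>],
              vector [0, of_real d1, 0, 0],
              vector [0, 0, of_real d2, 0],
              vector [0, 0, 0, of_real d3]]"
    and X: "X \<in> quats"
  shows "T X \<in> quats"
proof -
  have col: "T (quat_unit 0) = d0 *\<^sub>R quat_unit 0"
    "T (quat_unit 1) = d1 *\<^sub>R quat_unit 1 + (- g1) *\<^sub>R quat_unit 0"
    "T (quat_unit 2) = d2 *\<^sub>R quat_unit 2 + (- g2) *\<^sub>R quat_unit 0"
    "T (quat_unit 3) = d3 *\<^sub>R quat_unit 3 + (- g3) *\<^sub>R quat_unit 0"
    unfolding quat_unit_pauli clinear_scale[OF T] pauli_matrix_of_column[of T] M sum_4
      cscale_of_real[symmetric]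
    by (simp_all add: cmat.scale_right_distrib cscale_assoc cscale_0 algebra_simps)
  have r: "r *\<^sub>R Y \<in> quats" if "Y \<in> quats" for r Y
    using quats_scaleR[OF that, of r] by (simp add: cscale_of_real)
  have four: "{..<4} = {0, 1, 2, 3 :: nat}" by auto
  have "T (quat_unit i) \<in> quats" if "i < 4" for i
    using less4_cases[OF that]
    by (elim disjE) (simp_all only: col, (intro quats_add r quat_unit_in_quats)+)
  then show ?thesis
    by (subst quat_expand[OF X])
      (simp add: four clinear_add[OF T] clinear_scaleR[OF T] quats_add r)
qed

lemma diagonal_pauli_form:
  assumes T: "clinear T" and d: "\<forall>i<4. T (quat_unit i) = d i *\<^sub>R quat_unit i"
  shows "pauli_matrix_of T =
    vector [vector [of_real (d 0), 0, 0, 0], vector [0, of_real (d 1), 0, 0],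
      vector [0, 0, of_real (d 2), 0], vector [0, 0, 0, of_real (d 3)]]"
proof -
  have scale: "T P = r *\<^sub>R P" if "Q = z *\<^sub>M P" "z \<noteq> 0" "T Q = r *\<^sub>R Q" for P Q z r
  proof -
    have P: "P = inverse z *\<^sub>M Q" using that(1,2) by (simp add: cscale_assoc cscale_1)
    then have "T P = inverse z *\<^sub>M (complex_of_real r *\<^sub>M Q)"
      by (simp add: clinear_scale[OF T] that(3) cscale_of_real)
    also have "\<dots> = r *\<^sub>R P" unfolding P cscale_of_real[symmetric] by (simp add: cscale_assoc mult.commute)
    finally show ?thesis .
  qed
  have col: "T (pauli_basis $ 1) = of_real (d 0) *\<^sub>M pauli_basis $ 1"
    "T (pauli_basis $ 2) = of_real (d 1) *\<^sub>M pauli_basis $ 2"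
    "T (pauli_basis $ 3) = of_real (d 2) *\<^sub>M pauli_basis $ 3"
    "T (pauli_basis $ 4) = of_real (d 3) *\<^sub>M pauli_basis $ 4"
    unfolding cscale_of_real
    by (rule scale[OF quat_unit_pauli(1)] scale[OF quat_unit_pauli(2)] scale[OF quat_unit_pauli(3)]
      scale[OF quat_unit_pauli(4)]; use d in simp)+
  have tr: "trace (c *\<^sub>M A) = c * trace A" for c and A :: "complex^2^2"
    by (simp add: trace_def cscale_def sum_distrib_left)
  show ?thesis
    by (simp add: vec_eq_iff forall_4 pauli_matrix_of_nth col cscale_mult_right tr pauli_basis_orthonormal)
qed

section \<open>Preservers of the triangle equality\<close>

lemma preserves_TEA_imp_parallel:
  assumes T: "clinear T" and TEA: "preserves_TEA T"
  shows "preserves_parallel T"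
  unfolding preserves_parallel_def parallel_iff_TEA
  using TEA by (metis T clinear_scale preserves_TEA_def)

lemma TEA_diag_flip:
  "TEA (mat2 b 0 0 a) (mat2 d 0 0 c) \<longleftrightarrow> TEA (mat2 a 0 0 b) (mat2 c 0 0 d)"
  using TEA_unitary[OF flip2_unitary flip2_unitary, of "mat2 a 0 0 b" "mat2 c 0 0 d"]
  by simp

lemma spectral_norm_eq_0: "spectral_norm A = 0 \<Longrightarrow> A = 0"
  using norm_le_spectral[of A] by (simp add: matrix_eq)

text \<open>The first two equations give \<open>\<bar>g\<bar> = \<bar>h\<bar>\<close>, and with the parallelogram law \<open>h = g\<close> or \<open>h = - g\<close>. Each of the last two
  equations excludes one sign, because \<open>sqrt 10 \<noteq> 2 + sqrt 2\<close>.\<close>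

lemma collinear_sign_pairs:
  fixes g h :: complex
  assumes 1: "cmod (2 * g) = cmod (g + h) + cmod (g - h)"
    and 2: "cmod (2 * h) = cmod (g + h) + cmod (g - h)"
    and 3: "cmod (2 * g + (1 + \<i>) * h) = cmod (g + h) + cmod (g + \<i> * h)"
    and 4: "cmod (2 * g + (\<i> - 1) * h) = cmod (g + \<i> * h) + cmod (g - h)"
  shows "g = 0 \<and> h = 0"
proof -
  define s t G where "s = cmod (g + h)" and "t = cmod (g - h)" and "G = cmod g"
  have st: "s + t = 2 * G" and H: "cmod h = G" using 1 2 by (simp_all add: s_def t_def G_def norm_mult)
  have "s\<^sup>2 + t\<^sup>2 = 2 * G\<^sup>2 + 2 * (cmod h)\<^sup>2"
    unfolding s_def t_def G_def cmod_power2 by (simp add: power2_eq_square algebra_simps)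
  moreover have "(s + t)\<^sup>2 = 4 * G\<^sup>2" unfolding st by (simp add: power_mult_distrib)
  ultimately have "s * t = 0" by (simp add: H power2_sum)
  have ne: "sqrt 10 \<noteq> 2 + sqrt 2"
  proof
    assume "sqrt 10 = 2 + sqrt 2"
    then have "(sqrt 10)\<^sup>2 = (2 + sqrt 2)\<^sup>2" by simp
    then have "sqrt 2 = 1" by (simp add: power2_sum)
    then show False by simp
  qed
  have mods: "cmod (3 + \<i>) = sqrt 10" "cmod (3 - \<i>) = sqrt 10" "cmod (1 + \<i>) = sqrt 2" "cmod (1 - \<i>) = sqrt 2"
    by (simp_all add: cmod_def)
  from \<open>s * t = 0\<close> consider "h = g" | "h = - g"
    by (auto simp: s_def t_def eq_neg_iff_add_eq_0 add.commute)
  then have "cmod g = 0"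
  proof cases
    case 1
    have "cmod ((3 + \<i>) * g) = cmod (2 * g) + cmod ((1 + \<i>) * g)"
      using 3 by (simp add: 1 algebra_simps)
    then have "(sqrt 10 - (2 + sqrt 2)) * cmod g = 0"
      by (simp only: norm_mult mods) (simp add: algebra_simps)
    then show ?thesis using ne by simp
  next
    case 2
    have "cmod ((3 - \<i>) * g) = cmod (2 * g) + cmod ((1 - \<i>) * g)"
      using 4 by (simp add: 2 algebra_simps)
    then have "(sqrt 10 - (2 + sqrt 2)) * cmod g = 0"
      by (simp only: norm_mult mods) (simp add: algebra_simps)
    then show ?thesis using ne by simp
  qed
  then show ?thesis using H by (simp add: G_def)
qed

text \<open>In bases that make \<open>A\<close> diagonal, \<open>T\<close> sends \<open>diag(a, d)\<close> to \<open>(a g + d h) Z\<close>. Diagonal matrices with dominant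
  positive first entry, and likewise those with dominant positive second entry, form triangle
  equality attaining pairs among themselves; four such pairs give the equations of
  \<open>collinear_sign_pairs\<close>.\<close>

lemma rank_one_TEA_preserver_zero:
  assumes T: "clinear T" and TEA: "preserves_TEA T" and "\<forall>A. \<exists>c. T A = c *\<^sub>M Z"
  shows "T A = 0"
proof (cases "Z = 0")
  case True
  then show ?thesis using assms(3) by (metis cscale_zero)
next
  case False
  then have z: "spectral_norm Z \<noteq> 0" using spectral_norm_eq_0 by blast
  obtain U V a b where UV: "U \<in> unit_quats" "V \<in> unit_quats" "U ** A ** V = mat2 a 0 0 b"
    by (rule singular_values)
  note unit = unit_quats_unitary[OF UV(1)] unit_quats_unitary[OF UV(2)]
  define S where "S A = T (adjoint_matrix U ** A ** adjoint_matrix V)" for A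
  have S: "clinear S"
    using clinear_unitary[OF T, of "mat 1" "adjoint_matrix U" "adjoint_matrix V" "mat 1"]
    by (simp add: S_def[abs_def])
  obtain g h where gh: "S (mat2 1 0 0 0) = g *\<^sub>M Z" "S (mat2 0 0 0 1) = h *\<^sub>M Z"
    using assms(3) unfolding S_def by metis
  have Sd: "S (mat2 a 0 0 d) = (a * g + d * h) *\<^sub>M Z" for a d
    using clinear_entries[OF S, of a 0 0 d] by (simp add: gh cscale_assoc cscale_distrib cscale_0)
  have STEA: "cmod ((a * g + b * h) + (c * g + d * h)) = cmod (a * g + b * h) + cmod (c * g + d * h)"
    if "TEA (mat2 a 0 0 b) (mat2 c 0 0 d)" for a b c d
  proof -
    have "TEA (S (mat2 a 0 0 b)) (S (mat2 c 0 0 d))"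
      using TEA that TEA_unitary[OF unit[THEN unitary_adjoint]]
      by (simp add: S_def preserves_TEA_def)
    then have "cmod ((a * g + b * h) + (c * g + d * h)) * spectral_norm Z
      = (cmod (a * g + b * h) + cmod (c * g + d * h)) * spectral_norm Z"
      unfolding TEA_def Sd cscale_distrib[symmetric] spectral_norm_cscale by (simp add: distrib_right)
    then show ?thesis using z by simp
  qed
  have tea: "TEA (mat2 1 0 0 x) (mat2 1 0 0 y)" if "cmod x \<le> 1" "cmod y \<le> 1" for x y
    using TEA_diagI[of 1 1 x y] that by simp
  have "g = 0 \<and> h = 0"
  proof (rule collinear_sign_pairs)
    show "cmod (2 * g) = cmod (g + h) + cmod (g - h)"
      using STEA[OF tea[of 1 "-1"]] by simp
    have "TEA (mat2 1 0 0 1) (mat2 (-1) 0 0 1)"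
      using tea[of 1 "-1"] TEA_diag_flip by simp
    from STEA[OF this] show "cmod (2 * h) = cmod (g + h) + cmod (g - h)"
      by (simp add: norm_minus_commute)
    show "cmod (2 * g + (1 + \<i>) * h) = cmod (g + h) + cmod (g + \<i> * h)"
      using STEA[OF tea[of 1 \<i>]] by (simp add: algebra_simps)
    show "cmod (2 * g + (\<i> - 1) * h) = cmod (g + \<i> * h) + cmod (g - h)"
      using STEA[OF tea[of \<i> "-1"]] by (simp add: algebra_simps)
  qed
  moreover have "T A = S (mat2 a 0 0 b)"
    unfolding S_def UV(3)[symmetric] unitary_undo[OF unit] ..
  ultimately show ?thesis by (simp add: Sd cscale_0)
qed

text \<open>Squaring leaves \<open>\<bar>\<alpha>\<bar> * sqrt (\<alpha>\<^sup>2 + \<beta>\<^sup>2) = \<alpha>\<^sup>2\<close>.\<close>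

lemma norm_equality_forces_zero:
  fixes \<alpha> \<beta> :: real
  assumes "\<bar>\<beta>\<bar> \<le> \<bar>\<alpha>\<bar>" "sqrt (4 * \<alpha>\<^sup>2 + \<beta>\<^sup>2) = \<bar>\<alpha>\<bar> + sqrt (\<alpha>\<^sup>2 + \<beta>\<^sup>2)"
  shows "\<beta> = 0"
proof -
  define s where "s = sqrt (\<alpha>\<^sup>2 + \<beta>\<^sup>2)"
  have s2: "s\<^sup>2 = \<alpha>\<^sup>2 + \<beta>\<^sup>2" by (simp add: s_def)
  have "(sqrt (4 * \<alpha>\<^sup>2 + \<beta>\<^sup>2))\<^sup>2 = (\<bar>\<alpha>\<bar> + s)\<^sup>2" using assms(2) by (simp add: s_def)
  then have "4 * \<alpha>\<^sup>2 + \<beta>\<^sup>2 = \<alpha>\<^sup>2 + s\<^sup>2 + 2 * \<bar>\<alpha>\<bar> * s" by (simp add: power2_sum)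
  then have "\<bar>\<alpha>\<bar> * s = \<bar>\<alpha>\<bar> * \<bar>\<alpha>\<bar>" using s2 by (simp add: power2_eq_square)
  then have "\<alpha> = 0 \<or> s = \<bar>\<alpha>\<bar>" by (metis abs_eq_0 mult_left_cancel)
  then show ?thesis using s2 assms(1) by auto
qed

text \<open>The pair \<open>diag(1, 0)\<close>, \<open>diag(1, \<i>)\<close> attains the triangle equality. With \<open>\<alpha> = d0 + d1\<close> and \<open>\<beta> = d0 - d1\<close> its image is
  \<open>diag(\<alpha>, \<beta>) / 2\<close>, \<open>diag(\<alpha> + \<i> \<beta>, \<beta> + \<i> \<alpha>) / 2\<close>, whose dominant entries have the same direction
  only if \<open>\<alpha>\<close> or \<open>\<beta>\<close> vanishes.\<close>

lemma TEA_preserver_equal_moduli: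
  assumes T: "clinear T" and TEA: "preserves_TEA T"
    and d: "T (quat_unit 0) = d0 *\<^sub>R quat_unit 0" "T (quat_unit 1) = d1 *\<^sub>R quat_unit 1"
  shows "\<bar>d0\<bar> = \<bar>d1\<bar>"
proof -
  define \<alpha> \<beta> where "\<alpha> = d0 + d1" and "\<beta> = d0 - d1"
  have Td: "T (mat2 a 0 0 b) = mat2 ((a * \<alpha> + b * \<beta>) / 2) 0 0 ((a * \<beta> + b * \<alpha>) / 2)" for a b
  proof -
    have "mat2 a 0 0 b = ((a + b) / 2) *\<^sub>M quat_unit 0 + (- (\<i> * (a - b) / 2)) *\<^sub>M quat_unit 1"
      by (simp add: quat_unit_def quat_def field_simps)
    then have "T (mat2 a 0 0 b) = ((a + b) / 2) *\<^sub>M (d0 *\<^sub>R quat_unit 0) + (- (\<i> * (a - b) / 2)) *\<^sub>M (d1 *\<^sub>R quat_unit 1)"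
      by (simp only: clinear_add[OF T] clinear_scale[OF T] d)
    then show ?thesis by (simp add: quat_unit_def quat_def \<alpha>_def \<beta>_def field_simps)
  qed
  \<comment> \<open>All diagonal entries below are brought to the shape (x + i y) / 2 with real x, y, so that this
    equation evaluates the norms.\<close>
  have c: "cmod ((of_real x + \<i> * of_real y) / 2) = sqrt (x\<^sup>2 + y\<^sup>2) / 2" for x y
    unfolding norm_divide by (simp add: cmod_def)
  have "TEA (mat2 1 0 0 0) (mat2 1 0 0 \<i>)"
    using TEA_diagI[of 1 1 0 \<i>] by simp
  then have "TEA (T (mat2 1 0 0 0)) (T (mat2 1 0 0 \<i>))"
    using TEA by (simp add: preserves_TEA_def)
  then have "spectral_norm (mat2 ((of_real (2 * \<alpha>) + \<i> * of_real \<beta>) / 2) 0 0 ((of_real (2 * \<beta>) + \<i> * of_real \<alpha>) / 2))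
    = spectral_norm (mat2 ((of_real \<alpha> + \<i> * of_real 0) / 2) 0 0 ((of_real \<beta> + \<i> * of_real 0) / 2))
    + spectral_norm (mat2 ((of_real \<alpha> + \<i> * of_real \<beta>) / 2) 0 0 ((of_real \<beta> + \<i> * of_real \<alpha>) / 2))"
    by (simp add: TEA_def Td field_simps)
  then have "max (sqrt (4 * \<alpha>\<^sup>2 + \<beta>\<^sup>2) / 2) (sqrt (4 * \<beta>\<^sup>2 + \<alpha>\<^sup>2) / 2)
    = max (\<bar>\<alpha>\<bar> / 2) (\<bar>\<beta>\<bar> / 2) + sqrt (\<alpha>\<^sup>2 + \<beta>\<^sup>2) / 2"
    unfolding spectral_norm_diag c by (simp add: power_mult_distrib add.commute)
  then have eq: "max (sqrt (4 * \<alpha>\<^sup>2 + \<beta>\<^sup>2)) (sqrt (4 * \<beta>\<^sup>2 + \<alpha>\<^sup>2)) = max \<bar>\<alpha>\<bar> \<bar>\<beta>\<bar> + sqrt (\<alpha>\<^sup>2 + \<beta>\<^sup>2)"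
    by (simp add: max_def split: if_splits)
  have "\<alpha> = 0 \<or> \<beta> = 0"
  proof (cases "\<bar>\<beta>\<bar> \<le> \<bar>\<alpha>\<bar>")
    case True
    then have "4 * \<beta>\<^sup>2 + \<alpha>\<^sup>2 \<le> 4 * \<alpha>\<^sup>2 + \<beta>\<^sup>2" by (simp add: abs_le_square_iff)
    then show ?thesis using norm_equality_forces_zero[OF True] eq True by (simp add: max_def split: if_splits)
  next
    case False
    then have F: "\<bar>\<alpha>\<bar> \<le> \<bar>\<beta>\<bar>" by simp
    then have "4 * \<alpha>\<^sup>2 + \<beta>\<^sup>2 \<le> 4 * \<beta>\<^sup>2 + \<alpha>\<^sup>2" by (simp add: abs_le_square_iff)
    then show ?thesis using norm_equality_forces_zero[OF F] eq False
      by (simp add: max_def add.commute split: if_splits)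
  qed
  then show ?thesis by (auto simp: \<alpha>_def \<beta>_def)
qed

text \<open>A quarter turn in the plane of the first and the \<open>i\<close>-th imaginary unit fixes \<open>1\<close>
  and moves the first unit to the \<open>i\<close>-th, which reduces the claim to \<open>i = 1\<close>.\<close>

lemma TEA_preserver_equal_moduli_all:
  assumes T: "clinear T" and TEA: "preserves_TEA T"
    and d: "\<forall>i<4. T (quat_unit i) = d i *\<^sub>R quat_unit i" and i: "i < 4"
  shows "\<bar>d i\<bar> = \<bar>d 0\<bar>"
proof -
  consider "i = 0" | "i = 1" | "1 < i" by linarith
  then show ?thesis
  proof cases
    case 2
    then show ?thesis using TEA_preserver_equal_moduli[OF T TEA, of "d 0" "d 1"] d by simp
  next
    case 3
    obtain U V where UV: "U \<in> unit_quats" "V \<in> unit_quats"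
      "U ** quat_unit 1 ** V = 0 *\<^sub>R quat_unit 1 + 1 *\<^sub>R quat_unit i"
      "\<And>l. l < 4 \<Longrightarrow> l \<noteq> 1 \<Longrightarrow> l \<noteq> i \<Longrightarrow> U ** quat_unit l ** V = quat_unit l"
      using plane_rotation[OF 3 i, of 0 1] by (metis add_0 one_power2 zero_power2)
    note unit = unit_quats_unitary[OF UV(1)] unit_quats_unitary[OF UV(2)]
    define S where "S A = adjoint_matrix U ** T (U ** A ** V) ** adjoint_matrix V" for A
    have S: "clinear S" unfolding S_def by (rule clinear_unitary[OF T])
    have STEA: "preserves_TEA S" unfolding S_def
      by (intro preserves_TEA_unitary unitary_adjoint unit TEA)
    have undo: "adjoint_matrix U ** (U ** A ** V) ** adjoint_matrix V = A" for A
      by (rule unitary_undo[OF unit])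
    have img: "S A = r *\<^sub>R A" if "T (U ** A ** V) = r *\<^sub>R (U ** A ** V)" for A r
    proof -
      have "S A = complex_of_real r *\<^sub>M (adjoint_matrix U ** (U ** A ** V) ** adjoint_matrix V)"
        unfolding S_def that cscale_of_real[symmetric] by (simp only: cscale_mult_left cscale_mult_right)
      then show ?thesis unfolding undo cscale_of_real .
    qed
    have "S (quat_unit 0) = d 0 *\<^sub>R quat_unit 0"
      by (rule img) (use UV(4)[of 0] 3 d in simp)
    moreover have "S (quat_unit 1) = d i *\<^sub>R quat_unit 1"
      by (rule img) (use UV(3) i d in simp)
    ultimately have "\<bar>d 0\<bar> = \<bar>d i\<bar>" by (rule TEA_preserver_equal_moduli[OF S STEA])
    then show ?thesis by simp
  qed simp
qed

text \<open>In matrix entries, the signs of the first two basis quaternions act on the diagonal, by a common sign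
  if they agree and with an additional exchange of the two entries if they differ. The signs of the other two act
  on the off-diagonal entries in the same way. Common signs come from
  multiplication by diagonal sign matrices, exchanging both pairs of entries is conjugation by \<open>flip2\<close>, and exchanging the
  off-diagonal pair alone is transposition.\<close>

lemma sign_diagonal_form:
  assumes T: "clinear T" and d: "\<forall>i<4. T (quat_unit i) = d i *\<^sub>R quat_unit i"
    and moduli: "\<forall>i<4. \<bar>d i\<bar> = \<gamma>"
  obtains W1 W2 where "unitary_matrix W1" "unitary_matrix W2"
    "(\<forall>A. T A = \<gamma> *\<^sub>R (W1 ** A ** W2)) \<or> (\<forall>A. T A = \<gamma> *\<^sub>R (W1 ** transpose A ** W2))"
proof -
  define e where "e i = (if d i \<ge> 0 then 1 else -1 :: real)" for i
  have e: "d i = \<gamma> * e i" if "i < 4" for i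
    using moduli that by (auto simp: e_def abs_if split: if_splits)
  have T': "T (mat2 a b c d') = \<gamma> *\<^sub>R mat2
    (e 0 * (a + d') / 2 + e 1 * (a - d') / 2) (e 2 * (b + c) / 2 + e 3 * (b - c) / 2)
    (e 2 * (b + c) / 2 - e 3 * (b - c) / 2) (e 0 * (a + d') / 2 - e 1 * (a - d') / 2)" for a b c d' :: complex
  proof -
    have "mat2 a b c d' = ((a + d') / 2) *\<^sub>M quat_unit 0 + (- (\<i> * (a - d') / 2)) *\<^sub>M quat_unit 1
      + (- (\<i> * (b + c) / 2)) *\<^sub>M quat_unit 2 + ((b - c) / 2) *\<^sub>M quat_unit 3"
      by (simp add: quat_unit_def quat_def field_simps)
    then have "T (mat2 a b c d') = ((a + d') / 2) *\<^sub>M ((\<gamma> * e 0) *\<^sub>R quat_unit 0)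
      + (- (\<i> * (a - d') / 2)) *\<^sub>M ((\<gamma> * e 1) *\<^sub>R quat_unit 1)
      + (- (\<i> * (b + c) / 2)) *\<^sub>M ((\<gamma> * e 2) *\<^sub>R quat_unit 2)
      + ((b - c) / 2) *\<^sub>M ((\<gamma> * e 3) *\<^sub>R quat_unit 3)"
      using d e by (simp only: clinear_add[OF T] clinear_scale[OF T])
    then show ?thesis by (simp add: quat_unit_def quat_def field_simps)
  qed
  have sq: "e i = 1 \<or> e i = -1" for i by (simp add: e_def)
  define D1 where "D1 = mat2 1 0 0 (e 0 * e 2)"
  define D2 where "D2 = mat2 (e 0) 0 0 (e 2)"
  have D: "unitary_matrix D1" "unitary_matrix D2"
    using sq[of 0] sq[of 2] by (auto simp: unitary_matrix_def D1_def D2_def mat2_one)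
  note F = unitary_mult[OF D(1) flip2_unitary] unitary_mult[OF flip2_unitary D(2)]
  have form: "(\<forall>A. T A = \<gamma> *\<^sub>R G A) \<longleftrightarrow> (\<forall>a b c d. T (mat2 a b c d) = \<gamma> *\<^sub>R G (mat2 a b c d))" for G
    by (metis mat2_eta)
  consider "e 1 = e 0" "e 3 = e 2" | "e 1 = e 0" "e 3 = - e 2"
    | "e 1 = - e 0" "e 3 = e 2" | "e 1 = - e 0" "e 3 = - e 2"
    using sq[of 0] sq[of 1] sq[of 2] sq[of 3] by auto
  then show ?thesis
  proof cases
    case 1
    then have "\<forall>A. T A = \<gamma> *\<^sub>R (D1 ** A ** D2)"
      unfolding form T' using sq[of 0] sq[of 2] by (auto simp: D1_def D2_def field_simps)
    then show ?thesis using that D by blast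
  next
    case 2
    then have "\<forall>A. T A = \<gamma> *\<^sub>R (D1 ** transpose A ** D2)"
      unfolding form T' using sq[of 0] sq[of 2] by (auto simp: D1_def D2_def field_simps)
    then show ?thesis using that D by blast
  next
    case 3
    then have "\<forall>A. T A = \<gamma> *\<^sub>R ((D1 ** flip2) ** transpose A ** (flip2 ** D2))"
      unfolding form T' using sq[of 0] sq[of 2] by (auto simp: D1_def D2_def field_simps)
    then show ?thesis using that F by blast
  next
    case 4
    then have "\<forall>A. T A = \<gamma> *\<^sub>R ((D1 ** flip2) ** A ** (flip2 ** D2))"
      unfolding form T' using sq[of 0] sq[of 2] by (auto simp: D1_def D2_def field_simps)
    then show ?thesis using that F by blast
  qed
qed

text \<open>Transposing a singular value decomposition leaves its diagonal part unchanged.\<close>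

lemma spectral_norm_transpose:
  fixes A :: "complex^2^2"
  shows "spectral_norm (transpose A) = spectral_norm A"
proof -
  obtain U V a b where UV: "U \<in> unit_quats" "V \<in> unit_quats" "U ** A ** V = mat2 a 0 0 b"
    by (rule singular_values)
  note unit = unit_quats_unitary[OF UV(1)] unit_quats_unitary[OF UV(2)]
  have "spectral_norm A = spectral_norm (mat2 a 0 0 b)"
    using spectral_norm_unitary[OF unit, of A] UV(3) by simp
  also have "mat2 a 0 0 b = transpose (U ** A ** V)" unfolding UV(3) by simp
  also have "\<dots> = transpose V ** transpose A ** transpose U"
    by (simp add: matrix_transpose_mul matrix_mul_assoc)
  finally show ?thesis
    by (simp add: spectral_norm_unitary unitary_transpose unit)
qed

lemma scaled_isometry_preserves_TEA:
  assumes T: "clinear T" and "\<And>A. spectral_norm (T A) = \<gamma> * spectral_norm A"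
  shows "preserves_TEA T"
  unfolding preserves_TEA_def TEA_def
  by (simp add: assms(2) distrib_left flip: clinear_add[OF T])

lemma TEA_preserver_form:
  assumes T: "clinear T" and TEA: "preserves_TEA T"
  shows "\<exists>(\<gamma>::real) U V. \<gamma> \<ge> 0 \<and> unitary_matrix U \<and> unitary_matrix V \<and>
    ((\<forall>A. T A = \<gamma> *\<^sub>R (U ** A ** V)) \<or> (\<forall>A. T A = \<gamma> *\<^sub>R (U ** transpose A ** V)))"
  using parallel_preserver_normal_form[OF T preserves_TEA_imp_parallel[OF T TEA]]
proof (elim disjE exE conjE)
  fix Z assume "\<forall>A. \<exists>c. T A = c *\<^sub>M Z"
  then have "T A = 0" for A using rank_one_TEA_preserver_zero[OF T TEA] by blast
  then show ?thesis
    by (intro exI[of _ 0] exI[of _ "mat 1"]) (simp add: unit_quats_unitary unit_quats_one)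
next
  fix U1 V1 U2 V2 and d :: "nat \<Rightarrow> real"
  assume U: "unitary_matrix U1" "unitary_matrix V1" "unitary_matrix U2" "unitary_matrix V2"
    and d: "\<forall>i<4. U1 ** T (U2 ** quat_unit i ** V2) ** V1 = d i *\<^sub>R quat_unit i"
  define S where "S A = U1 ** T (U2 ** A ** V2) ** V1" for A
  have S: "clinear S" unfolding S_def by (rule clinear_unitary[OF T])
  have STEA: "preserves_TEA S" unfolding S_def by (intro preserves_TEA_unitary U TEA)
  have dS: "\<forall>i<4. S (quat_unit i) = d i *\<^sub>R quat_unit i" using d by (simp add: S_def)
  have moduli: "\<forall>i<4. \<bar>d i\<bar> = \<bar>d 0\<bar>"
    using TEA_preserver_equal_moduli_all[OF S STEA dS] by blast
  obtain W1 W2 where W: "unitary_matrix W1" "unitary_matrix W2"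
    "(\<forall>A. S A = \<bar>d 0\<bar> *\<^sub>R (W1 ** A ** W2)) \<or> (\<forall>A. S A = \<bar>d 0\<bar> *\<^sub>R (W1 ** transpose A ** W2))"
    by (rule sign_diagonal_form[OF S dS moduli])
  have TS: "T A = adjoint_matrix U1 ** S (adjoint_matrix U2 ** A ** adjoint_matrix V2) ** adjoint_matrix V1" for A
    unfolding S_def by (rule unitary_equivalence_inverse[OF U])
  have scale: "X ** (r *\<^sub>R Y) ** Z = r *\<^sub>R (X ** Y ** Z)" for X Y Z :: "complex^2^2" and r
    by (simp only: cscale_mult_left cscale_mult_right flip: cscale_of_real)
  from W(3) show ?thesis
  proof
    assume *: "\<forall>A. S A = \<bar>d 0\<bar> *\<^sub>R (W1 ** A ** W2)"
    have "T A = \<bar>d 0\<bar> *\<^sub>R ((adjoint_matrix U1 ** W1 ** adjoint_matrix U2) ** A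
      ** (adjoint_matrix V2 ** W2 ** adjoint_matrix V1))" for A
      unfolding TS *[rule_format] scale by (simp add: matrix_mul_assoc)
    moreover have "unitary_matrix (adjoint_matrix U1 ** W1 ** adjoint_matrix U2)"
      "unitary_matrix (adjoint_matrix V2 ** W2 ** adjoint_matrix V1)"
      by (intro unitary_mult unitary_adjoint U W)+
    ultimately show ?thesis by (meson abs_ge_zero)
  next
    assume *: "\<forall>A. S A = \<bar>d 0\<bar> *\<^sub>R (W1 ** transpose A ** W2)"
    have "T A = \<bar>d 0\<bar> *\<^sub>R ((adjoint_matrix U1 ** W1 ** transpose (adjoint_matrix V2)) ** transpose A
      ** (transpose (adjoint_matrix U2) ** W2 ** adjoint_matrix V1))" for A
      unfolding TS *[rule_format] scale by (simp add: matrix_mul_assoc matrix_transpose_mul)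
    moreover have "unitary_matrix (adjoint_matrix U1 ** W1 ** transpose (adjoint_matrix V2))"
      "unitary_matrix (transpose (adjoint_matrix U2) ** W2 ** adjoint_matrix V1)"
      by (intro unitary_mult unitary_adjoint unitary_transpose U W)+
    ultimately show ?thesis by (meson abs_ge_zero)
  qed
qed

lemma form_preserves_TEA:
  assumes T: "clinear T" and UV: "0 \<le> \<gamma>" "unitary_matrix U" "unitary_matrix V"
    and form: "(\<forall>A. T A = \<gamma> *\<^sub>R (U ** A ** V)) \<or> (\<forall>A. T A = \<gamma> *\<^sub>R (U ** transpose A ** V))"
  shows "preserves_TEA T"
proof (rule scaled_isometry_preserves_TEA[OF T])
  fix A
  have "spectral_norm (\<gamma> *\<^sub>R (U ** B ** V)) = \<gamma> * spectral_norm B" for B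
    using UV by (simp add: spectral_norm_unitary spectral_norm_cscale flip: cscale_of_real)
  then show "spectral_norm (T A) = \<gamma> * spectral_norm A"
    using form spectral_norm_transpose[of A] by metis
qed

section \<open>The classification\<close>

theorem theorem1p2:
  fixes T :: "complex^2^2 \<Rightarrow> complex^2^2"
  assumes "Vector_Spaces.linear cscale cscale T"
  shows
    "(preserves_TEA T \<longleftrightarrow>
       (\<exists>(\<gamma>::real) U V. \<gamma> \<ge> 0 \<and> unitary_matrix U \<and> unitary_matrix V \<and>
          ((\<forall>A. T A = \<gamma> *\<^sub>R (U ** A ** V)) \<or>
           (\<forall>A. T A = \<gamma> *\<^sub>R (U ** transpose A ** V)))))
     \<and>
     (preserves_parallel T \<longleftrightarrow>
       (\<exists>F Z. \<forall>A. T A = trace (F ** A) *\<^sub>M Z) \<or>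
       (\<exists>U1 U2 V1 V2. unitary_matrix U1 \<and> unitary_matrix U2 \<and>
          unitary_matrix V1 \<and> unitary_matrix V2 \<and>
          (\<exists>(d0::real) (d1::real) (d2::real) (d3::real) (\<gamma>1::real) (\<gamma>2::real) (\<gamma>3::real).
             pauli_matrix_of (\<lambda>A. U1 ** T (U2 ** A ** V2) ** V1) =
               vector
                 [vector [of_real d0, of_real \<gamma>1 * \<i>, of_real \<gamma>2 * \<i>, of_real \<gamma>3 * \<i>],
                  vector [0, of_real d1, 0, 0],
                  vector [0, 0, of_real d2, 0],
                  vector [0, 0, 0, of_real d3]])))"
proof (intro conjI iffI)
  assume "preserves_TEA T"
  with assms show "\<exists>(\<gamma>::real) U V. \<gamma> \<ge> 0 \<and> unitary_matrix U \<and> unitary_matrix V \<and>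
    ((\<forall>A. T A = \<gamma> *\<^sub>R (U ** A ** V)) \<or> (\<forall>A. T A = \<gamma> *\<^sub>R (U ** transpose A ** V)))"
    by (rule TEA_preserver_form)
next
  assume "\<exists>(\<gamma>::real) U V. \<gamma> \<ge> 0 \<and> unitary_matrix U \<and> unitary_matrix V \<and>
    ((\<forall>A. T A = \<gamma> *\<^sub>R (U ** A ** V)) \<or> (\<forall>A. T A = \<gamma> *\<^sub>R (U ** transpose A ** V)))"
  then show "preserves_TEA T" using form_preserves_TEA[OF assms] by blast
next
  assume "preserves_parallel T"
  from parallel_preserver_normal_form[OF assms this]
  show "(\<exists>F Z. \<forall>A. T A = trace (F ** A) *\<^sub>M Z) \<or>
       (\<exists>U1 U2 V1 V2. unitary_matrix U1 \<and> unitary_matrix U2 \<and>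
          unitary_matrix V1 \<and> unitary_matrix V2 \<and>
          (\<exists>(d0::real) (d1::real) (d2::real) (d3::real) (\<gamma>1::real) (\<gamma>2::real) (\<gamma>3::real).
             pauli_matrix_of (\<lambda>A. U1 ** T (U2 ** A ** V2) ** V1) =
               vector
                 [vector [of_real d0, of_real \<gamma>1 * \<i>, of_real \<gamma>2 * \<i>, of_real \<gamma>3 * \<i>],
                  vector [0, of_real d1, 0, 0],
                  vector [0, 0, of_real d2, 0],
                  vector [0, 0, 0, of_real d3]]))"
  proof (elim disjE exE conjE)
    fix Z assume "\<forall>A. \<exists>c. T A = c *\<^sub>M Z"
    then show ?thesis using rank_one_trace_form[OF assms] by blast
  next
    fix U1 V1 U2 V2 and d :: "nat \<Rightarrow> real"
    assume U: "unitary_matrix U1" "unitary_matrix V1" "unitary_matrix U2" "unitary_matrix V2"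
      and d: "\<forall>i<4. U1 ** T (U2 ** quat_unit i ** V2) ** V1 = d i *\<^sub>R quat_unit i"
    have "pauli_matrix_of (\<lambda>A. U1 ** T (U2 ** A ** V2) ** V1) = vector
      [vector [of_real (d 0), of_real 0 * \<i>, of_real 0 * \<i>, of_real 0 * \<i>],
       vector [0, of_real (d 1), 0, 0], vector [0, 0, of_real (d 2), 0],
       vector [0, 0, 0, of_real (d 3)]]"
      using diagonal_pauli_form[OF clinear_unitary[OF assms] d] by simp
    then show ?thesis using U by blast
  qed
next
  assume "(\<exists>F Z. \<forall>A. T A = trace (F ** A) *\<^sub>M Z) \<or>
       (\<exists>U1 U2 V1 V2. unitary_matrix U1 \<and> unitary_matrix U2 \<and>
          unitary_matrix V1 \<and> unitary_matrix V2 \<and>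
          (\<exists>(d0::real) (d1::real) (d2::real) (d3::real) (\<gamma>1::real) (\<gamma>2::real) (\<gamma>3::real).
             pauli_matrix_of (\<lambda>A. U1 ** T (U2 ** A ** V2) ** V1) =
               vector
                 [vector [of_real d0, of_real \<gamma>1 * \<i>, of_real \<gamma>2 * \<i>, of_real \<gamma>3 * \<i>],
                  vector [0, of_real d1, 0, 0],
                  vector [0, 0, of_real d2, 0],
                  vector [0, 0, 0, of_real d3]]))"
  then show "preserves_parallel T"
  proof (elim disjE exE conjE)
    fix F Z assume "\<forall>A. T A = trace (F ** A) *\<^sub>M Z"
    then have "T = (\<lambda>A. trace (F ** A) *\<^sub>M Z)" by blast
    then show ?thesis using rank_one_preserves_parallel by metis
  next
    fix U1 U2 V1 V2 d0 d1 d2 d3 \<gamma>1 \<gamma>2 \<gamma>3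
    assume U: "unitary_matrix U1" "unitary_matrix U2" "unitary_matrix V1" "unitary_matrix V2"
      and M: "pauli_matrix_of (\<lambda>A. U1 ** T (U2 ** A ** V2) ** V1) = vector
         [vector [of_real d0, of_real \<gamma>1 * \<i>, of_real \<gamma>2 * \<i>, of_real \<gamma>3 * \<i>],
          vector [0, of_real d1, 0, 0], vector [0, 0, of_real d2, 0], vector [0, 0, 0, of_real d3]]"
    have "preserves_parallel (\<lambda>A. U1 ** T (U2 ** A ** V2) ** V1)"
      by (intro quaternionic_preserves_parallel clinear_unitary[OF assms]
          pauli_form_quaternionic[OF clinear_unitary[OF assms] M])
    with U show ?thesis by (intro preserves_parallel_unitary[of U1 V1 U2 V2 T])
  qed
qed

end
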